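(* Let $m,n,p$ be positive integers with $p\ge2$. Then: (i) Orthogonal equivalence is an equivalence relation on $T(m,n,p)$, so $T(m,n,p)$ is partitioned into orthogonal equivalence classes. (ii) Each orthogonal equivalence class contains exactly one s-diagonal tensor. (iii) All the nonzero orthogonal equivalence classes (the classes of nonzero tensors) have the same cardinality, in the sense that a one-to-one correspondence can be established between any two such classes. (iv) Two s-diagonal tensors are equal if they are orthogonally equivalent. (v) All tensors in an orthogonal equivalence class have the same tensor tubal rank and the same T-singular values, and these can be calculated from the entries of the s-diagonal tensor $\mathcal{S}$ in that class: the tubal rank is the number of $i\in\{1,\dots,\min\{m,n\}\}$ such that the tube $\mathcal{S}(i,i,:)$ is nonzero, and the $i$th largest T-singular value is $\sqrt{\sum_{k=1}^p\mathcal{S}(i,i,k)^2}$ for $i=1,\dots,\min\{m,n\}$.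
   Context: Let $T(m,n,p)$ be the real linear space of $m\times n\times p$ real tensors; $\mathcal{A}(i,j,k)$ denotes the entries of $\mathcal{A}$ and $A^{(k)}=\mathcal{A}(:,:,k)$ its frontal slices, $k=1,\dots,p$. A tensor is f-diagonal if all its frontal slices are (rectangular) diagonal matrices; $F(m,n,p)$ is the set of f-diagonal tensors in $T(m,n,p)$. T-product and orthogonal tensors. For $\mathcal{A}\in T(m,n,p)$, $\mathrm{bcirc}(\mathcal{A})$ is the $mp\times np$ block circulant matrix whose $(r,s)$ block ($1\le r,s\le p$) is $A^{(t)}$ with $t\in\{1,\dots,p\}$, $t\equiv r-s+1 \pmod p$; $\mathrm{bcirc}^{-1}$ recovers $\mathcal{A}$ from $\mathrm{bcirc}(\mathcal{A})$. $\mathrm{unfold}(\mathcal{A})\in\mathbb{R}^{mp\times n}$ is the block column with blocks $A^{(1)},\dots,A^{(p)}$, and $\mathrm{fold}$ is its inverse. For $\mathcal{A}\in T(m,s,p)$, $\mathcal{B}\in T(s,n,p)$, the T-product is $\mathcal{A}*\mathcal{B}=\mathrm{fold}(\mathrm{bcirc}(\mathcal{A})\,\mathrm{unfold}(\mathcal{B}))\in T(m,n,p)$. The transpose is $\mathcal{A}^\top=\mathrm{bcirc}^{-1}[(\mathrm{bcirc}(\mathcal{A}))^\top]$ and the identity tensor is $\mathcal{I}_{nnp}=\mathrm{bcirc}^{-1}(I_{np})$. $\mathcal{U}\in T(m,m,p)$ is orthogonal if $\mathcal{U}*\mathcal{U}^\top=\mathcal{U}^\top*\mathcal{U}=\mathcal{I}_{mmp}$;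 $O(m,m,p)$ is the set of such tensors. Tensors $\mathcal{A},\mathcal{B}\in T(m,n,p)$ are orthogonally equivalent if $\mathcal{A}=\mathcal{U}*\mathcal{B}*\mathcal{V}^\top$ for some $\mathcal{U}\in O(m,m,p)$, $\mathcal{V}\in O(n,n,p)$. Kilmer-Martin mapping $G:T(m,n,p)\to F(m,n,p)$. Let $\omega=e^{2\pi\sqrt{-1}/p}$. For $\mathcal{A}\in T(m,n,p)$ and $k=1,\dots,p$ put $\Delta^{(k)}(\mathcal{A})=\sum_{l=1}^p\omega^{(l-1)(k-1)}A^{(l)}\in\mathbb{C}^{m\times n}$, and let $\mathcal{D}(i,i,k)$, $i=1,\dots,\min\{m,n\}$, be the singular values of $\Delta^{(k)}(\mathcal{A})$ in nonincreasing order (counted with multiplicity). Then $\mathcal{S}=G(\mathcal{A})$ is the f-diagonal tensor with $\mathcal{S}(i,i,k)=\frac1p\sum_{l=1}^p\bar\omega^{(k-1)(l-1)}\mathcal{D}(i,i,l)$ (these numbers are real). A tensor $\mathcal{S}\in F(m,n,p)$ is s-diagonal if $\mathcal{S}=G(\mathcal{A})$ for some $\mathcal{A}\in T(m,n,p)$. For $\mathcal{A}\in T(m,n,p)$ with $\mathcal{S}=G(\mathcal{A})$: the tensor tubal rank of $\mathcal{A}$ is the number of indices $i\in\{1,\dots,\min\{m,n\}\}$ with $\mathcal{S}(i,i,:)\ne 0$, and the $i$th largest T-singular value of $\mathcal{A}$ is $\sigma_i=\sqrt{\sum_{k=1}^p\mathcal{S}(i,i,k)^2}$.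
   Formalization: Part (iii) is stated only for (m,n) ≠ (1,1), since for m = n = 1 it is false: with p = 2 the class of the tube (1,0) has four elements and that of (1,1) has two; for p ≥ 3 the class of (1,…,1) has two elements while that of the identity tube is infinite. *)

theory Defs
  imports Complex_Main "HOL-Library.Disjoint_Sets" "Jordan_Normal_Form.Schur_Decomposition"
begin

text \<open>
  An $m \times n \times p$ real tensor is a function \<open>A i j k\<close> with zero-based indices that
  vanishes outside \<open>i < m\<close>, \<open>j < n\<close>, \<open>k < p\<close>, so that function equality is tensor equality.
\<close>

type_synonym tensor = "nat \<Rightarrow> nat \<Rightarrow> nat \<Rightarrow> real"

definition tensors :: "nat \<Rightarrow> nat \<Rightarrow> nat \<Rightarrow> tensor set" where
  "tensors m n p = {A. \<forall>i j k. \<not> (i < m \<and> j < n \<and> k < p) \<longrightarrow> A i j k = 0}"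

definition zero_tensor :: tensor where
  "zero_tensor = (\<lambda>i j k. 0)"

definition f_diagonal_tensors :: "nat \<Rightarrow> nat \<Rightarrow> nat \<Rightarrow> tensor set" where
  "f_diagonal_tensors m n p =
     {A \<in> tensors m n p. \<forall>i < m. \<forall>j < n. \<forall>k < p. i \<noteq> j \<longrightarrow> A i j k = 0}"

text \<open>
  Block \<open>(r, s)\<close> of \<open>bcirc\<close>, both zero-based, is the frontal slice with index $r - s$ modulo $p$;
  the summand \<open>p\<close> keeps the subtraction of naturals from truncating.
\<close>

definition bcirc :: "nat \<Rightarrow> nat \<Rightarrow> nat \<Rightarrow> tensor \<Rightarrow> real mat" where
  "bcirc m n p A =
     mat (m * p) (n * p) (\<lambda>(a, b). A (a mod m) (b mod n) ((p + a div m - b div n) mod p))"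

definition unfold_tensor :: "nat \<Rightarrow> nat \<Rightarrow> nat \<Rightarrow> tensor \<Rightarrow> real mat" where
  "unfold_tensor m n p A = mat (m * p) n (\<lambda>(a, j). A (a mod m) j (a div m))"

definition fold_tensor :: "nat \<Rightarrow> nat \<Rightarrow> nat \<Rightarrow> real mat \<Rightarrow> tensor" where
  "fold_tensor m n p M =
     (\<lambda>i j k. if i < m \<and> j < n \<and> k < p then M $$ (k * m + i, j) else 0)"

text \<open>The first block column of a block circulant matrix lists the frontal slices.\<close>

definition bcirc_inv :: "nat \<Rightarrow> nat \<Rightarrow> nat \<Rightarrow> real mat \<Rightarrow> tensor" where
  "bcirc_inv m n p M =
     (\<lambda>i j k. if i < m \<and> j < n \<and> k < p then M $$ (k * m + i, j) else 0)"

lemma block_index_less: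
  fixes i k m p :: nat
  assumes "i < m" "k < p"
  shows "k * m + i < m * p"
proof -
  have "k * m + i < (k + 1) * m" using assms by simp
  also have "\<dots> \<le> p * m" using assms by (intro mult_le_mono1) simp
  finally show ?thesis by (simp add: mult.commute)
qed

lemma fold_unfold_tensor:
  assumes "A \<in> tensors m n p"
  shows "fold_tensor m n p (unfold_tensor m n p A) = A"
  using assms
  by (intro ext) (auto simp: fold_tensor_def unfold_tensor_def tensors_def block_index_less)

lemma bcirc_inv_bcirc:
  assumes "A \<in> tensors m n p"
  shows "bcirc_inv m n p (bcirc m n p A) = A"
proof (intro ext)
  fix i j k
  have "j < n * p" if "j < n" "k < p"
    using that by (cases p) auto
  then show "bcirc_inv m n p (bcirc m n p A) i j k = A i j k"
    using assms by (auto simp: bcirc_inv_def bcirc_def tensors_def block_index_less)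
qed

definition t_prod :: "nat \<Rightarrow> nat \<Rightarrow> nat \<Rightarrow> nat \<Rightarrow> tensor \<Rightarrow> tensor \<Rightarrow> tensor" where
  "t_prod m s n p A B = fold_tensor m n p (bcirc m s p A * unfold_tensor s n p B)"

definition t_transpose :: "nat \<Rightarrow> nat \<Rightarrow> nat \<Rightarrow> tensor \<Rightarrow> tensor" where
  "t_transpose m n p A = bcirc_inv n m p (transpose_mat (bcirc m n p A))"

definition t_identity :: "nat \<Rightarrow> nat \<Rightarrow> tensor" where
  "t_identity n p = bcirc_inv n n p (1\<^sub>m (n * p))"

definition orthogonal_tensors :: "nat \<Rightarrow> nat \<Rightarrow> tensor set" where
  "orthogonal_tensors m p =
     {U \<in> tensors m m p.
        t_prod m m m p U (t_transpose m m p U) = t_identity m p \<and>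
        t_prod m m m p (t_transpose m m p U) U = t_identity m p}"

definition orth_equiv :: "nat \<Rightarrow> nat \<Rightarrow> nat \<Rightarrow> (tensor \<times> tensor) set" where
  "orth_equiv m n p =
     {(A, B). A \<in> tensors m n p \<and> B \<in> tensors m n p \<and>
        (\<exists>U \<in> orthogonal_tensors m p. \<exists>V \<in> orthogonal_tensors n p.
           A = t_prod m n n p (t_prod m m n p U B) (t_transpose n n p V))}"

definition orth_class :: "nat \<Rightarrow> nat \<Rightarrow> nat \<Rightarrow> tensor \<Rightarrow> tensor set" where
  "orth_class m n p A = orth_equiv m n p `` {A}"

text \<open>
  The case $m = n = 1$ is exceptional for the cardinality of the classes: for $p = 2$ the class
  of the tube $(1, 0)$ has four elements, while that of $(1, 1)$ has at most two.
\<close>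

context
  fixes tube :: "real \<Rightarrow> real \<Rightarrow> tensor"
  assumes tube: "tube = (\<lambda>x y i j k. if i = 0 \<and> j = 0 \<and> k = 0 then x
                                    else if i = 0 \<and> j = 0 \<and> k = 1 then y else 0)"
begin

private lemma tensors_1_1_2: "A \<in> tensors 1 1 2 \<longleftrightarrow> (\<exists>x y. A = tube x y)"
proof
  assume A: "A \<in> tensors 1 1 2"
  have "A = tube (A 0 0 0) (A 0 0 1)"
    using A by (intro ext) (auto simp: tensors_def tube less_2_cases_iff)
  then show "\<exists>x y. A = tube x y" by blast
qed (auto simp: tensors_def tube)

private lemma tube_eq_iff: "tube x y = tube x' y' \<longleftrightarrow> x = x' \<and> y = y'"
proof
  assume "tube x y = tube x' y'"
  then have "tube x y 0 0 0 = tube x' y' 0 0 0" "tube x y 0 0 1 = tube x' y' 0 0 1" by simp_all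
  then show "x = x' \<and> y = y'" by (simp add: tube)
qed simp

private lemma t_prod_tube:
  "t_prod 1 1 1 2 (tube a b) (tube c d) = tube (a * c + b * d) (b * c + a * d)"
proof -
  have sum2: "(\<Sum>i = 0..<2. h i) = h 0 + h 1" for h :: "nat \<Rightarrow> real"
    by (simp add: numeral_2_eq_2)
  show ?thesis
    by (intro ext)
      (auto simp: t_prod_def fold_tensor_def bcirc_def unfold_tensor_def tube scalar_prod_def
        less_2_cases_iff sum2)
qed

private lemma t_transpose_tube: "t_transpose 1 1 2 (tube a b) = tube a b"
  by (intro ext)
    (auto simp: t_transpose_def bcirc_inv_def bcirc_def tube less_2_cases_iff)

private lemma t_identity_tube: "t_identity 1 2 = tube 1 0"
  by (intro ext) (auto simp: t_identity_def bcirc_inv_def tube less_2_cases_iff)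

private lemma orthogonal_tube_iff:
  "tube a b \<in> orthogonal_tensors 1 2 \<longleftrightarrow> a * a + b * b = 1 \<and> a * b = 0"
  using tensors_1_1_2
  by (auto simp: orthogonal_tensors_def t_transpose_tube[simplified] t_prod_tube[simplified]
      t_identity_tube[simplified] tube_eq_iff)

private lemma orthogonal_tubeE:
  assumes "U \<in> orthogonal_tensors 1 2"
  obtains a b where "U = tube a b" "a = 0 \<and> (b = 1 \<or> b = -1) \<or> b = 0 \<and> (a = 1 \<or> a = -1)"
proof -
  from assms have "U \<in> tensors 1 1 2" by (simp add: orthogonal_tensors_def)
  then obtain a b where U: "U = tube a b" using tensors_1_1_2 by blast
  have "a * a + b * b = 1" "a * b = 0"
    using assms orthogonal_tube_iff unfolding U by blast+
  then have "a = 0 \<and> b * b = 1 \<or> b = 0 \<and> a * a = 1"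
    unfolding mult_eq_0_iff by auto
  with that U show ?thesis unfolding square_eq_1_iff by blast
qed

lemma orth_classes_1_1_2_not_equinumerous:
  "\<not> (\<forall>A \<in> tensors 1 1 2. \<forall>B \<in> tensors 1 1 2.
         A \<noteq> zero_tensor \<and> B \<noteq> zero_tensor \<longrightarrow>
         (\<exists>f. bij_betw f (orth_class 1 1 2 A) (orth_class 1 1 2 B)))"
proof
  assume *: "\<forall>A \<in> tensors 1 1 2. \<forall>B \<in> tensors 1 1 2.
         A \<noteq> zero_tensor \<and> B \<noteq> zero_tensor \<longrightarrow>
         (\<exists>f. bij_betw f (orth_class 1 1 2 A) (orth_class 1 1 2 B))"
  have zero: "zero_tensor = tube 0 0"
    by (intro ext) (simp add: zero_tensor_def tube)
  obtain f where f: "bij_betw f (orth_class 1 1 2 (tube 1 0)) (orth_class 1 1 2 (tube 1 1))"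
    using * tensors_1_1_2 zero tube_eq_iff by (metis zero_neq_one)
  have sub: "orth_class 1 1 2 (tube 1 1) \<subseteq> {tube 1 1, tube (-1) (-1)}"
  proof
    fix B assume "B \<in> orth_class 1 1 2 (tube 1 1)"
    then have B: "B \<in> tensors 1 1 2"
      and "\<exists>U \<in> orthogonal_tensors 1 2. \<exists>V \<in> orthogonal_tensors 1 2.
             tube 1 1 = t_prod 1 1 1 2 (t_prod 1 1 1 2 U B) (t_transpose 1 1 2 V)"
      by (auto simp: orth_class_def orth_equiv_def)
    then obtain U V where UV: "U \<in> orthogonal_tensors 1 2" "V \<in> orthogonal_tensors 1 2"
      and eq: "tube 1 1 = t_prod 1 1 1 2 (t_prod 1 1 1 2 U B) (t_transpose 1 1 2 V)" by blast
    obtain x y where xy: "B = tube x y" using B tensors_1_1_2 by blast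
    obtain a b where ab: "U = tube a b" "a = 0 \<and> (b = 1 \<or> b = -1) \<or> b = 0 \<and> (a = 1 \<or> a = -1)"
      using UV(1) by (rule orthogonal_tubeE)
    obtain c d where cd: "V = tube c d" "c = 0 \<and> (d = 1 \<or> d = -1) \<or> d = 0 \<and> (c = 1 \<or> c = -1)"
      using UV(2) by (rule orthogonal_tubeE)
    have e: "1 = (a * x + b * y) * c + (b * x + a * y) * d"
            "1 = (b * x + a * y) * c + (a * x + b * y) * d"
      using eq unfolding xy ab(1) cd(1) t_transpose_tube t_prod_tube tube_eq_iff by auto
    have "x = 1 \<and> y = 1 \<or> x = -1 \<and> y = -1"
      using ab(2) cd(2) e by (elim disjE conjE) simp_all
    then show "B \<in> {tube 1 1, tube (-1) (-1)}" using xy by auto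
  qed
  have mem: "tube x y \<in> orth_class 1 1 2 (tube 1 0)"
    if "x * x + y * y = 1" "x * y = 0" for x y
  proof -
    have "tube x y \<in> orthogonal_tensors 1 2" "tube 1 0 \<in> orthogonal_tensors 1 2"
      using that orthogonal_tube_iff by auto
    moreover have "tube 1 0 =
        t_prod 1 1 1 2 (t_prod 1 1 1 2 (tube x y) (tube x y)) (t_transpose 1 1 2 (tube 1 0))"
      using that unfolding t_transpose_tube t_prod_tube tube_eq_iff by (simp add: mult.commute)
    ultimately show ?thesis
      using tensors_1_1_2 unfolding orth_class_def orth_equiv_def by blast
  qed
  have "{tube 1 0, tube 0 1, tube (-1) 0} \<subseteq> orth_class 1 1 2 (tube 1 0)"
    using mem[of 1 0] mem[of 0 1] mem[of "-1" 0] by simp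
  moreover have "finite (orth_class 1 1 2 (tube 1 0))"
    using f sub bij_betw_finite finite_subset by blast
  ultimately have "card {tube 1 0, tube 0 1, tube (-1) 0} \<le> card (orth_class 1 1 2 (tube 1 0))"
    by (intro card_mono)
  also have "\<dots> = card (orth_class 1 1 2 (tube 1 1))" using f by (rule bij_betw_same_card)
  also have "\<dots> \<le> card {tube 1 1, tube (-1) (-1)}" using sub by (intro card_mono) auto
  also have "\<dots> \<le> 2" by (simp add: card_insert_if)
  finally show False by (simp add: tube_eq_iff)
qed

end

text \<open>
  The square roots of the eigenvalues of $M^* M$, with multiplicity and in nonincreasing order.
  For an $m \times n$ matrix there are $n$ of them, and the singular values are the first
  $\min\{m, n\}$; the remaining ones are zero.  The eigenvalues are real and nonnegative, so
  taking the real part loses nothing.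
\<close>

definition singular_values :: "complex mat \<Rightarrow> real list" where
  "singular_values M =
     rev (sorted_list_of_multiset
       (image_mset (\<lambda>z. sqrt (Re z)) (proots (char_poly (mat_adjoint M * M)))))"

definition root_unity :: "nat \<Rightarrow> complex" where
  "root_unity p = exp (2 * of_real pi * \<i> / of_nat p)"

definition fourier_slice :: "nat \<Rightarrow> nat \<Rightarrow> nat \<Rightarrow> tensor \<Rightarrow> nat \<Rightarrow> complex mat" where
  "fourier_slice m n p A k =
     mat m n (\<lambda>(i, j). \<Sum>l<p. root_unity p ^ (l * k) * of_real (A i j l))"

text \<open>
  The Kilmer--Martin mapping $G$.  The sum defining an entry is real because the slices with
  indices $l$ and $p - l$ are complex conjugate and hence have the same singular values; \<open>Re\<close>
  only adjusts the type.
\<close>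

definition kilmer_martin :: "nat \<Rightarrow> nat \<Rightarrow> nat \<Rightarrow> tensor \<Rightarrow> tensor" where
  "kilmer_martin m n p A =
     (\<lambda>i j k. if i = j \<and> i < min m n \<and> k < p
        then Re (1 / of_nat p *
          (\<Sum>l<p. cnj (root_unity p) ^ (k * l) *
             of_real (singular_values (fourier_slice m n p A l) ! i)))
        else 0)"

definition s_diagonal :: "nat \<Rightarrow> nat \<Rightarrow> nat \<Rightarrow> tensor \<Rightarrow> bool" where
  "s_diagonal m n p S \<longleftrightarrow>
     S \<in> f_diagonal_tensors m n p \<and> (\<exists>A \<in> tensors m n p. S = kilmer_martin m n p A)"

definition tubal_rank :: "nat \<Rightarrow> nat \<Rightarrow> nat \<Rightarrow> tensor \<Rightarrow> nat" where
  "tubal_rank m n p A =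
     card {i. i < min m n \<and> (\<exists>k < p. kilmer_martin m n p A i i k \<noteq> 0)}"

definition t_singular_value :: "nat \<Rightarrow> nat \<Rightarrow> nat \<Rightarrow> tensor \<Rightarrow> nat \<Rightarrow> real" where
  "t_singular_value m n p A i = sqrt (\<Sum>k<p. (kilmer_martin m n p A i i k)\<^sup>2)"

end

theory Submission
  imports Defs "HOL-Analysis.Abstract_Topology_2"
begin

text \<open>
  The discrete Fourier transform along the third index turns the T-product into the slicewise
  matrix product, the T-transpose into the adjoint and orthogonal tensors into families of unitary
  slices; it is a bijection from real tensors onto the families of complex slices in which
  the slices \<open>k\<close> and \<open>p - k\<close> are conjugate.  Orthogonal equivalence thus becomes slicewise unitary
  equivalence, for which the ordered singular values are invariant, so $G$ is constant on classes and
  idempotent.  Choosing singular value decompositions of the slices compatibly with conjugation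
  shows that $\mathcal{A}$ is equivalent to $G(\mathcal{A})$.  For the cardinality, rotating two
  rows (or columns) of a nonzero tensor by the angles in $[0, \pi]$ yields a continuum
  of tensors in its class.
\<close>

section \<open>Adjoints and unitary matrices\<close>

text \<open>The obstacle is reality. Slices come from a real tensor only if those with indices
  \<open>k\<close> and \<open>p - k\<close> are conjugate, so the slices \<open>k = 0\<close> and
  \<open>2 * k = p\<close> are real and their unitary factors must be real too. Therefore the
  singular value decomposition is built from explicit reflections and eigenvectors, each carrying
  the clause that real input gives real output. \<open>singular_values\<close> is defined by the
  characteristic polynomial of the Gram matrix \<open>mat_adjoint M * M\<close>. Unitary invariance
  is then similarity of Gram matrices, and any decomposition with an ordered nonnegative diagonal
  displays exactly these values. The rotations bound the size of a nonzero class only from below;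
  the bound from above embeds all real functions of three natural indices into the reals. Two
  classes are thus compared through the reals, not by a direct map. Rotating requires a second row
  or column. For \<open>m = n = 1\<close> the slices are scalars and only phases can change, which
  is why the cardinality clause excludes this case;
  \<open>orth_classes_1_1_2_not_equinumerous\<close> refutes it there for
  \<open>p = 2\<close>.\<close>

lemma dim_mat_adjoint [simp]:
  "dim_row (mat_adjoint A) = dim_col A" "dim_col (mat_adjoint A) = dim_row A"
  by (auto simp: mat_adjoint_def)

lemma index_mat_adjoint [simp]:
  fixes A :: "complex mat"
  assumes "i < dim_col A" "j < dim_row A"
  shows "mat_adjoint A $$ (i, j) = cnj (A $$ (j, i))"
  using assms by (auto simp: mat_adjoint_def mat_of_rows_def)

lemma mat_adjoint_carrier [simp]:
  "A \<in> carrier_mat m n \<Longrightarrow> mat_adjoint A \<in> carrier_mat n m"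
  by (rule carrier_matI) auto

lemma mat_adjoint_mat_adjoint [simp]: "mat_adjoint (mat_adjoint A) = (A :: complex mat)"
  by (rule eq_matI) auto

lemma mat_adjoint_one [simp]: "mat_adjoint (1\<^sub>m n) = (1\<^sub>m n :: complex mat)"
  by (rule eq_matI) auto

text \<open>Dimensions instead of carrier sets keep the premises free of variables that rewriting
  would have to guess, so long products can be reassociated by simplification.\<close>

lemma assoc_mult_mat_dim:
  fixes A B C :: "'a :: semiring_0 mat"
  assumes "dim_col A = dim_row B" "dim_col B = dim_row C"
  shows "(A * B) * C = A * (B * C)"
  using assms by (intro assoc_mult_mat[of A _ "dim_col A" B "dim_col B"]) auto

lemma mat_adjoint_mult:
  fixes A B :: "complex mat"
  assumes "dim_col A = dim_row B"
  shows "mat_adjoint (A * B) = mat_adjoint B * mat_adjoint A"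
  using assms by (intro eq_matI) (auto simp: scalar_prod_def mult.commute)

lemma map_mat_cnj_mult:
  fixes A B :: "complex mat"
  assumes "dim_col A = dim_row B"
  shows "map_mat cnj (A * B) = map_mat cnj A * map_mat cnj B"
  using assms by (intro eq_matI) (auto simp: scalar_prod_def)

lemma map_mat_cnj_adjoint: "map_mat cnj (mat_adjoint A) = mat_adjoint (map_mat cnj A)"
  by (rule eq_matI) auto

lemma map_mat_cnj_cnj [simp]: "map_mat cnj (map_mat cnj A) = A"
  by (rule eq_matI) auto

definition unitary_mats :: "nat \<Rightarrow> complex mat set" where
  "unitary_mats n =
     {P \<in> carrier_mat n n. P * mat_adjoint P = 1\<^sub>m n \<and> mat_adjoint P * P = 1\<^sub>m n}"

lemma unitary_matsD:
  assumes "P \<in> unitary_mats n"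
  shows "P \<in> carrier_mat n n" "P * mat_adjoint P = 1\<^sub>m n" "mat_adjoint P * P = 1\<^sub>m n"
  using assms by (auto simp: unitary_mats_def)

lemma unitary_matsI:
  assumes "P \<in> carrier_mat n n" "mat_adjoint P * P = 1\<^sub>m n"
  shows "P \<in> unitary_mats n"
  using assms mat_mult_left_right_inverse[of "mat_adjoint P" n P]
  by (auto simp: unitary_mats_def)

lemma unitary_mats_one [simp]: "1\<^sub>m n \<in> unitary_mats n"
  by (auto simp: unitary_mats_def)

lemma unitary_mats_adjoint [simp]: "P \<in> unitary_mats n \<Longrightarrow> mat_adjoint P \<in> unitary_mats n"
  by (auto simp: unitary_mats_def)

lemma unitary_mats_mult:
  assumes "P \<in> unitary_mats n" "Q \<in> unitary_mats n"
  shows "P * Q \<in> unitary_mats n"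
proof (rule unitary_matsI)
  note P = unitary_matsD[OF assms(1)] and Q = unitary_matsD[OF assms(2)]
  show "P * Q \<in> carrier_mat n n" using P Q by auto
  have "mat_adjoint (P * Q) * (P * Q) = mat_adjoint Q * mat_adjoint P * (P * Q)"
    using P Q by (subst mat_adjoint_mult) auto
  also have "\<dots> = mat_adjoint Q * (mat_adjoint P * P) * Q"
    using P(1) Q(1) by (simp add: assoc_mult_mat_dim)
  also have "\<dots> = 1\<^sub>m n" using P Q by simp
  finally show "mat_adjoint (P * Q) * (P * Q) = 1\<^sub>m n" .
qed

lemma unitary_mats_cnj: "P \<in> unitary_mats n \<Longrightarrow> map_mat cnj P \<in> unitary_mats n"
proof (rule unitary_matsI)
  assume P: "P \<in> unitary_mats n"
  note P = unitary_matsD[OF P]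
  show "map_mat cnj P \<in> carrier_mat n n" using P by auto
  have "mat_adjoint (map_mat cnj P) * map_mat cnj P = map_mat cnj (mat_adjoint P * P)"
    using P(1) by (subst map_mat_cnj_mult) (auto simp: map_mat_cnj_adjoint)
  also have "\<dots> = 1\<^sub>m n" unfolding P by (rule eq_matI) auto
  finally show "mat_adjoint (map_mat cnj P) * map_mat cnj P = 1\<^sub>m n" .
qed

text \<open>The reflection exchanging the first unit vector and \<open>u\<close>: it is
  \<open>1 - c w w^H\<close> with \<open>w\<close> their difference and
  \<open>c = 2 / |w|^2\<close>. As \<open>u 0\<close> is real, \<open>|w|^2 = 2 (1 - u 0)\<close>,
  which gives \<open>c = 1 / (1 - u 0)\<close> and makes the matrix Hermitian.\<close>

lemma householder_matrix:
  fixes u :: "nat \<Rightarrow> complex"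
  assumes n: "n > 0" and u: "(\<Sum>i<n. u i * cnj (u i)) = 1" and u0: "u 0 \<in> \<real>"
  shows "\<exists>P \<in> unitary_mats n. (\<forall>i<n. P $$ (i, 0) = u i) \<and>
           ((\<forall>i<n. u i \<in> \<real>) \<longrightarrow> map_mat cnj P = P)"
proof -
  define w where "w = (\<lambda>i. (if i = 0 then 1 else 0) - u i)"
  \<comment> \<open>For \<open>u 0 = 1\<close> the division gives \<open>c = 0\<close>, hence the identity matrix.\<close>
  define c where "c = 1 / (1 - u 0)"
  define P where "P = mat n n (\<lambda>(i, j). (if i = j then 1 else 0) - c * w i * cnj (w j))"
  have cnj_u0: "cnj (u 0) = u 0" using u0 by (simp add: Reals_cnj_iff)
  have cnj_c: "cnj c = c" by (simp add: c_def cnj_u0)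
  have "(\<Sum>i<n. w i * cnj (w i)) = (\<Sum>i<n. (if i = 0 then 1 - u 0 - cnj (u 0) else 0) + u i * cnj (u i))"
    by (intro sum.cong) (auto simp: w_def algebra_simps)
  also have "\<dots> = 2 * (1 - u 0)"
    using n by (simp add: sum.distrib u cnj_u0)
  finally have w: "(\<Sum>i<n. w i * cnj (w i)) = 2 * (1 - u 0)" .
  have adj: "mat_adjoint P = P"
    by (rule eq_matI) (auto simp: P_def cnj_c)
  have PP: "P * P = 1\<^sub>m n"
  proof (rule eq_matI)
    fix i j assume "i < dim_row (1\<^sub>m n)" "j < dim_col (1\<^sub>m n)"
    then have ij: "i < n" "j < n" by auto
    have "(P * P) $$ (i, j) = (\<Sum>k<n. ((if i = k then 1 else 0) - c * w i * cnj (w k)) *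
            ((if k = j then 1 else 0) - c * w k * cnj (w j)))"
      using ij by (simp add: P_def scalar_prod_def lessThan_atLeast0)
    also have "\<dots> = (\<Sum>k<n. (if k = i then if i = j then 1 else 0 else 0)
          - (if k = i then c * w i * cnj (w j) else 0) - (if k = j then c * w i * cnj (w j) else 0)
          + c * c * w i * cnj (w j) * (w k * cnj (w k)))"
      by (intro sum.cong) (auto simp: algebra_simps)
    also have "\<dots> = (if i = j then 1 else 0) - 2 * c * w i * cnj (w j)
          + c * c * w i * cnj (w j) * (2 * (1 - u 0))"
      using ij by (simp add: sum.distrib sum_subtractf w flip: sum_distrib_left)
    also have "\<dots> = (if i = j then 1 else 0)"
    proof -
      \<comment> \<open>This also holds for \<open>u 0 = 1\<close>, where both sides are 0.\<close>
      have "c * c * (1 - u 0) = c" by (simp add: c_def)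
      moreover have "c * c * w i * cnj (w j) * (2 * (1 - u 0)) =
          2 * (c * c * (1 - u 0)) * w i * cnj (w j)"
        by (simp only: mult_ac)
      ultimately show ?thesis by (simp only:) simp
    qed
    finally show "(P * P) $$ (i, j) = 1\<^sub>m n $$ (i, j)" using ij by simp
  qed (auto simp: P_def)
  have "P \<in> unitary_mats n"
    by (rule unitary_matsI) (auto simp: adj PP, simp add: P_def)
  moreover have "P $$ (i, 0) = u i" if i: "i < n" for i
  proof (cases "u 0 = 1")
    case True
    \<comment> \<open>Here \<open>|w|^2 = 2 (1 - u 0) = 0\<close>, so \<open>w\<close> vanishes and
      \<open>u\<close> is itself the first unit vector.\<close>
    have "(\<Sum>k<n. (cmod (w k))\<^sup>2) = Re (\<Sum>k<n. w k * cnj (w k))"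
      by (simp add: complex_mult_cnj cmod_power2)
    then have "(\<Sum>k<n. (cmod (w k))\<^sup>2) = 0" unfolding w by (simp add: True)
    then have "w i = 0" using i by (simp add: sum_nonneg_eq_0_iff)
    then show ?thesis using n i by (auto simp: P_def w_def)
  next
    case False
    then show ?thesis using n i by (auto simp: P_def w_def c_def cnj_u0 field_simps)
  qed
  moreover have "map_mat cnj P = P" if "\<forall>i<n. u i \<in> \<real>"
    using that by (intro eq_matI) (auto simp: P_def cnj_c w_def Reals_cnj_iff)
  ultimately show ?thesis by blast
qed

text \<open>Dividing \<open>u\<close> by the phase of its first entry makes that entry real, as the
  reflection requires; scaling the reflection by the phase restores \<open>u\<close>. A real
  \<open>u\<close> has phase 1 or -1, so the matrix remains real.\<close>

lemma unitary_first_column: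
  fixes u :: "complex vec"
  assumes n: "n > 0" and u: "u \<in> carrier_vec n" and norm: "u \<bullet>c u = 1"
  shows "\<exists>P \<in> unitary_mats n. col P 0 = u \<and> (conjugate u = u \<longrightarrow> map_mat cnj P = P)"
proof -
  \<comment> \<open>The phase of \<open>u $ 0\<close>, with the value 1 when the entry vanishes, so
    that \<open>a\<close> is unimodular in all cases.\<close>
  define a where "a = (if u $ 0 = 0 then 1 else u $ 0 / of_real (cmod (u $ 0)))"
  have a1: "a * cnj a = 1"
    by (simp add: a_def complex_norm_square[symmetric] norm_divide)
  have "cnj a * u $ 0 = of_real (cmod (u $ 0))"
    using complex_norm_square[of "u $ 0"] by (auto simp: a_def power2_eq_square mult.commute divide_eq_eq)
  then have a2: "cnj a * u $ 0 \<in> \<real>" by simp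
  have norm': "(\<Sum>i<n. u $ i * cnj (u $ i)) = 1"
    using u norm by (simp add: scalar_prod_def lessThan_atLeast0)
  have "(\<Sum>i<n. (cnj a * u $ i) * cnj (cnj a * u $ i)) = (a * cnj a) * (\<Sum>i<n. u $ i * cnj (u $ i))"
    by (simp add: sum_distrib_left mult_ac)
  then have "(\<Sum>i<n. (cnj a * u $ i) * cnj (cnj a * u $ i)) = 1" by (simp add: a1 norm')
  from householder_matrix[OF n this a2] obtain P where P: "P \<in> unitary_mats n"
    "\<And>i. i < n \<Longrightarrow> P $$ (i, 0) = cnj a * u $ i"
    "(\<forall>i<n. cnj a * u $ i \<in> \<real>) \<longrightarrow> map_mat cnj P = P" by blast
  note P' = unitary_matsD[OF P(1)]
  show ?thesis
  proof (intro bexI conjI impI)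
    show "col (a \<cdot>\<^sub>m P) 0 = u"
      using P' u n P(2) a1 by (intro eq_vecI) (simp_all flip: mult.assoc)
    have "mat_adjoint (a \<cdot>\<^sub>m P) * (a \<cdot>\<^sub>m P) = (a * cnj a) \<cdot>\<^sub>m (mat_adjoint P * P)"
      using P'(1) by (intro eq_matI) (auto simp: scalar_prod_def sum_distrib_left mult_ac)
    then show "a \<cdot>\<^sub>m P \<in> unitary_mats n"
      using P' by (intro unitary_matsI eq_matI) (auto simp: a1)
    assume "conjugate u = u"
    then have *: "cnj (u $ i) = u $ i" if "i < n" for i
      using that u by (metis carrier_vecD conjugate_complex_def vec_index_conjugate)
    then have "cnj a = a" using n by (simp add: a_def)
    then show "map_mat cnj (a \<cdot>\<^sub>m P) = a \<cdot>\<^sub>m P"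
      using P(3) * P' by (intro eq_matI) (auto simp: Reals_cnj_iff, metis index_map_mat(1) carrier_matD)
  qed
qed

section \<open>Singular values\<close>

text \<open>The direct sum of a scalar and a possibly rectangular matrix: the shape left after one
  singular value has been split off.\<close>

definition bordered :: "complex \<Rightarrow> complex mat \<Rightarrow> complex mat" where
  "bordered a X =
     four_block_mat (mat 1 1 (\<lambda>_. a)) (0\<^sub>m 1 (dim_col X)) (0\<^sub>m (dim_row X) 1) X"

lemma dim_bordered [simp]:
  "dim_row (bordered a X) = Suc (dim_row X)" "dim_col (bordered a X) = Suc (dim_col X)"
  by (auto simp: bordered_def)

lemma bordered_carrier [simp]:
  "X \<in> carrier_mat m n \<Longrightarrow> bordered a X \<in> carrier_mat (Suc m) (Suc n)"
  by (rule carrier_matI) auto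

lemma index_bordered:
  assumes "i < Suc (dim_row X)" "j < Suc (dim_col X)"
  shows "bordered a X $$ (i, j) =
           (if i = 0 \<and> j = 0 then a else if i = 0 \<or> j = 0 then 0 else X $$ (i - 1, j - 1))"
  using assms by (auto simp: bordered_def)

lemma bordered_mult:
  assumes "dim_col X = dim_row Y"
  shows "bordered a X * bordered b Y = bordered (a * b) (X * Y)"
proof -
  have "mat 1 1 (\<lambda>_. a) * mat 1 1 (\<lambda>_. b) = mat 1 1 (\<lambda>_. a * b)"
    by (rule eq_matI) (auto simp: scalar_prod_def)
  then show ?thesis unfolding bordered_def
    using assms
    by (subst mult_four_block_mat[of _ 1 1 _ "dim_col X" _ "dim_row X" _ _ 1 _ "dim_col Y"]) auto
qed

lemma mat_adjoint_bordered: "mat_adjoint (bordered a X) = bordered (cnj a) (mat_adjoint X)"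
  by (rule eq_matI) (auto simp: index_bordered)

lemma map_mat_cnj_bordered: "map_mat cnj (bordered a X) = bordered (cnj a) (map_mat cnj X)"
  by (rule eq_matI) (auto simp: index_bordered)

lemma bordered_one: "bordered 1 (1\<^sub>m n) = 1\<^sub>m (Suc n)"
  by (rule eq_matI) (auto simp: index_bordered)

lemma bordered_unitary:
  assumes "P \<in> unitary_mats n"
  shows "bordered 1 P \<in> unitary_mats (Suc n)"
  using unitary_matsD[OF assms]
  by (intro unitary_matsI) (auto simp: mat_adjoint_bordered bordered_mult bordered_one)

text \<open>Values of \<open>d\<close> from \<open>min m n\<close> on do not show in the matrix.
  Lemmas on singular values require zeros there as far as necessary, to match the \<open>n\<close>
  entries of \<open>singular_values\<close>.\<close>

definition diag_rect :: "nat \<Rightarrow> nat \<Rightarrow> (nat \<Rightarrow> real) \<Rightarrow> complex mat" where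
  "diag_rect m n d = mat m n (\<lambda>(i, j). if i = j then of_real (d i) else 0)"

lemma diag_rect_carrier [simp]: "diag_rect m n d \<in> carrier_mat m n"
  by (simp add: diag_rect_def)

lemma dim_diag_rect [simp]: "dim_row (diag_rect m n d) = m" "dim_col (diag_rect m n d) = n"
  by (auto simp: diag_rect_def)

lemma diag_rect_Suc:
  "diag_rect (Suc m) (Suc n) (case_nat a d) = bordered (of_real a) (diag_rect m n d)"
  by (rule eq_matI) (auto simp: diag_rect_def index_bordered split: nat.splits)

text \<open>The factor \<open>P\<close> cancels in the Gram matrix, which leaves a conjugation by
  \<open>Q\<close>, that is, a similarity.\<close>

lemma char_poly_gram_unitary:
  assumes P: "P \<in> unitary_mats m" and Q: "Q \<in> unitary_mats n" and N: "N \<in> carrier_mat m n"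
    and M: "M = P * N * mat_adjoint Q"
  shows "char_poly (mat_adjoint M * M) = char_poly (mat_adjoint N * N)"
proof (rule char_poly_similar, unfold similar_mat_def, intro exI)
  note P = unitary_matsD[OF P] and Q = unitary_matsD[OF Q]
  have "mat_adjoint M * M = Q * (mat_adjoint N * (mat_adjoint P * P) * N) * mat_adjoint Q"
    unfolding M using P(1) Q(1) N by (simp add: mat_adjoint_mult assoc_mult_mat_dim del: assoc_mult_mat)
  also have "mat_adjoint N * (mat_adjoint P * P) * N = mat_adjoint N * N"
    using N P by simp
  finally have "mat_adjoint M * M = Q * (mat_adjoint N * N) * mat_adjoint Q" .
  then show "similar_mat_wit (mat_adjoint M * M) (mat_adjoint N * N) Q (mat_adjoint Q)"
    using Q P(1) N M by (intro similar_mat_witI[of _ _ n]) auto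
qed

lemma char_poly_bordered:
  assumes "X \<in> carrier_mat n n"
  shows "char_poly (bordered a X) = [:- a, 1:] * char_poly X"
proof -
  have "char_poly (mat 1 1 (\<lambda>_. a)) = [:- a, 1:]"
    by (subst char_poly_upper_triangular[of _ 1]) (auto simp: diag_mat_def)
  then show ?thesis
    using assms by (simp only: bordered_def carrier_matD)
      (subst char_poly_four_block_zeros_col[of _ _ n], auto)
qed

text \<open>Every root belonging to \<open>X\<close> is still a root for the bordered matrix; this
  later forces the singular values of \<open>X\<close> to be at most the one split off.\<close>

lemma char_poly_gram_bordered:
  "char_poly (mat_adjoint (bordered (of_real s) X) * bordered (of_real s) X) =
     [:- of_real (s\<^sup>2), 1:] * char_poly (mat_adjoint X * X)"
proof -
  have "mat_adjoint (bordered (of_real s) X) * bordered (of_real s) X =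
      bordered (of_real (s\<^sup>2)) (mat_adjoint X * X)"
    by (simp add: mat_adjoint_bordered bordered_mult power2_eq_square)
  then show ?thesis
    by (simp only:) (rule char_poly_bordered[of _ "dim_col X"], auto)
qed

lemma char_poly_gram_svd:
  assumes P: "P \<in> unitary_mats m" and Q: "Q \<in> unitary_mats n"
    and M: "M = P * diag_rect m n d * mat_adjoint Q" and d: "\<And>i. i \<ge> m \<Longrightarrow> d i = 0"
  shows "char_poly (mat_adjoint M * M) = (\<Prod>a \<leftarrow> map (\<lambda>i. of_real ((d i)\<^sup>2)) [0..<n]. [:- a, 1:])"
proof -
  have "mat_adjoint (diag_rect m n d) * diag_rect m n d =
      mat n n (\<lambda>(i, j). if i = j then of_real ((d i)\<^sup>2) else 0)"
  proof (rule eq_matI, goal_cases)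
    case (1 i j)
    then have "(mat_adjoint (diag_rect m n d) * diag_rect m n d) $$ (i, j) =
        (\<Sum>k<m. cnj (if k = i then of_real (d k) else 0) * (if k = j then of_real (d k) else 0))"
      by (simp add: diag_rect_def scalar_prod_def lessThan_atLeast0)
    also have "\<dots> = (\<Sum>k<m. if k = i then if i = j then of_real ((d i)\<^sup>2) else 0 else 0)"
      by (rule sum.cong) (auto simp: power2_eq_square)
    \<comment> \<open>For \<open>i \<ge> m\<close> the index \<open>i\<close> does not occur in the
      sum, and the right side is 0 because \<open>d i = 0\<close>.\<close>
    also have "\<dots> = (if i = j then of_real ((d i)\<^sup>2) else 0)"
      using d[of i] by auto
    finally show ?case using 1 by simp
  qed auto
  moreover have "diag_mat (mat n n (\<lambda>(i, j). if i = j then complex_of_real ((d i)\<^sup>2) else 0)) =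
      map (\<lambda>i. of_real ((d i)\<^sup>2)) [0..<n]"
    by (auto simp: diag_mat_def)
  ultimately show ?thesis
    using char_poly_upper_triangular[of "mat n n (\<lambda>(i, j). if i = j then complex_of_real ((d i)\<^sup>2) else 0)" n]
    by (simp add: char_poly_gram_unitary[OF P Q diag_rect_carrier M] upper_triangular_def)
qed

text \<open>The Gram matrix has the roots \<open>(d i)\<^sup>2\<close> with multiplicity;
  nonnegativity lets the square root recover \<open>d i\<close>, and antitonicity fixes the order.
  So the diagonal does not depend on the decomposition chosen.\<close>

lemma singular_values_svd:
  assumes "P \<in> unitary_mats m" "Q \<in> unitary_mats n" "M = P * diag_rect m n d * mat_adjoint Q"
    and "\<And>i. i \<ge> m \<Longrightarrow> d i = 0" and d: "antimono d" "\<And>i. 0 \<le> d i"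
  shows "singular_values M = map d [0..<n]"
proof -
  have "proots (\<Prod>a \<leftarrow> as. [:- a, 1:]) = mset as" for as :: "complex list"
  proof (induction as)
    case (Cons a as)
    have "(\<Prod>a \<leftarrow> as. [:- a, 1:]) \<noteq> 0"
      by (induction as) (simp_all del: mult_pCons_left)
    then have "proots ([:- a, 1:] * (\<Prod>a \<leftarrow> as. [:- a, 1:])) =
        proots [:- a, 1:] + proots (\<Prod>a \<leftarrow> as. [:- a, 1:])"
      by (intro proots_mult) auto
    then show ?case using Cons by (simp del: mult_pCons_left)
  qed simp
  moreover have "char_poly (mat_adjoint M * M) =
      (\<Prod>a \<leftarrow> map (\<lambda>i. of_real ((d i)\<^sup>2)) [0..<n]. [:- a, 1:])"
    by (rule char_poly_gram_svd) (fact assms)+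
  ultimately have "image_mset (\<lambda>z. sqrt (Re z)) (proots (char_poly (mat_adjoint M * M))) =
      mset (map d [0..<n])"
    by (simp only:) (simp add: d(2) multiset.map_comp o_def del: of_real_power)
  moreover have "sort (map d [0..<n]) = rev (map d [0..<n])"
  proof (rule properties_for_sort)
    show "sorted (rev (map d [0..<n]))"
      using d(1) by (auto simp: sorted_rev_iff_nth_mono antimono_def)
  qed simp
  ultimately show ?thesis
    by (simp only: singular_values_def sorted_list_of_multiset_mset rev_rev_ident)
qed

section \<open>Singular value decomposition\<close>

lemma cscalar_prod_self:
  fixes v :: "complex vec"
  shows "v \<bullet>c v = of_real (\<Sum>i<dim_vec v. (cmod (v $ i))\<^sup>2)"
  by (simp add: scalar_prod_def lessThan_atLeast0 complex_norm_square del: of_real_power)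

lemma mat_adjoint_cscalar_prod:
  fixes A :: "complex mat"
  assumes "A \<in> carrier_mat m n" "y \<in> carrier_vec m" "x \<in> carrier_vec n"
  shows "(mat_adjoint A *\<^sub>v y) \<bullet>c x = y \<bullet>c (A *\<^sub>v x)"
proof -
  have "(mat_adjoint A *\<^sub>v y) \<bullet>c x = (\<Sum>i<n. \<Sum>k<m. cnj (A $$ (k, i)) * y $ k * cnj (x $ i))"
    using assms by (simp add: scalar_prod_def lessThan_atLeast0 sum_distrib_right)
  also have "\<dots> = (\<Sum>k<m. \<Sum>i<n. cnj (A $$ (k, i)) * y $ k * cnj (x $ i))"
    by (rule sum.swap)
  also have "\<dots> = y \<bullet>c (A *\<^sub>v x)"
    using assms by (simp add: scalar_prod_def lessThan_atLeast0 sum_distrib_left mult_ac)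
  finally show ?thesis .
qed

text \<open>The first equation exhibits \<open>\<mu>\<close> as the quotient of the squared norms of
  \<open>M v\<close> and \<open>v\<close>, hence as a nonnegative real.\<close>

lemma gram_eigenvector:
  fixes M :: "complex mat"
  assumes M: "M \<in> carrier_mat m n" and v: "eigenvector (mat_adjoint M * M) v \<mu>"
  shows "(M *\<^sub>v v) \<bullet>c (M *\<^sub>v v) = \<mu> * (v \<bullet>c v)" "\<mu> = of_real (Re \<mu>)" "0 \<le> Re \<mu>"
proof -
  from v M have v: "v \<in> carrier_vec n" "v \<noteq> 0\<^sub>v n" "(mat_adjoint M * M) *\<^sub>v v = \<mu> \<cdot>\<^sub>v v"
    by (auto simp: eigenvector_def)
  have "(M *\<^sub>v v) \<bullet>c (M *\<^sub>v v) = (mat_adjoint M *\<^sub>v (M *\<^sub>v v)) \<bullet>c v"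
    using M v by (subst mat_adjoint_cscalar_prod[OF M]) auto
  also have "mat_adjoint M *\<^sub>v (M *\<^sub>v v) = \<mu> \<cdot>\<^sub>v v"
    using M v by (metis assoc_mult_mat_vec mat_adjoint_carrier)
  also have "(\<mu> \<cdot>\<^sub>v v) \<bullet>c v = \<mu> * (v \<bullet>c v)"
    using v by simp
  finally show eq: "(M *\<^sub>v v) \<bullet>c (M *\<^sub>v v) = \<mu> * (v \<bullet>c v)" .
  have "v \<bullet>c v \<noteq> 0" using v by simp
  define s where "s = (\<Sum>i<dim_vec v. (cmod (v $ i))\<^sup>2)"
  define t where "t = (\<Sum>i<dim_vec (M *\<^sub>v v). (cmod ((M *\<^sub>v v) $ i))\<^sup>2)"
  have s: "v \<bullet>c v = of_real s" unfolding s_def by (rule cscalar_prod_self)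
  then have "s \<noteq> 0" using \<open>v \<bullet>c v \<noteq> 0\<close> by auto
  moreover have "s \<ge> 0" "t \<ge> 0"
    by (auto simp: s_def t_def intro: sum_nonneg)
  moreover have "of_real t = \<mu> * of_real s"
    using eq by (simp only: cscalar_prod_self[of "M *\<^sub>v v"] s flip: t_def)
  ultimately have "\<mu> = of_real (t / s)" by (simp add: field_simps)
  then show "\<mu> = of_real (Re \<mu>)" "0 \<le> Re \<mu>" using \<open>s \<ge> 0\<close> \<open>t \<ge> 0\<close> by auto
qed

lemma sum_diag_mult_commute:
  fixes A B :: "'a :: comm_semiring_0 mat"
  assumes "A \<in> carrier_mat n n" "B \<in> carrier_mat n n"
  shows "(\<Sum>i<n. (A * B) $$ (i, i)) = (\<Sum>i<n. (B * A) $$ (i, i))"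
proof -
  have "(\<Sum>i<n. (A * B) $$ (i, i)) = (\<Sum>i<n. \<Sum>k<n. A $$ (i, k) * B $$ (k, i))"
    using assms by (simp add: scalar_prod_def lessThan_atLeast0)
  also have "\<dots> = (\<Sum>k<n. \<Sum>i<n. B $$ (k, i) * A $$ (i, k))"
    by (subst sum.swap) (simp add: mult.commute)
  also have "\<dots> = (\<Sum>i<n. (B * A) $$ (i, i))"
    using assms by (simp add: scalar_prod_def lessThan_atLeast0)
  finally show ?thesis .
qed

text \<open>By Schur, \<open>H\<close> is similar to a triangular matrix with the eigenvalues on its
  diagonal, and similarity preserves the trace.\<close>

lemma trace_eq_0_if_eigenvalues_0:
  fixes H :: "complex mat"
  assumes H: "H \<in> carrier_mat n n" and ev: "\<And>\<mu>. eigenvalue H \<mu> \<Longrightarrow> \<mu> = 0"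
  shows "(\<Sum>i<n. H $$ (i, i)) = 0"
proof -
  obtain as where as: "char_poly H = (\<Prod>a \<leftarrow> as. [:- a, 1:])"
    using char_poly_factorized[OF H] by blast
  obtain B P Q where "schur_decomposition H as = (B, P, Q)" by (metis prod_cases3)
  from schur_decomposition[OF H as this]
  have wit: "similar_mat_wit H B P Q" and diag: "diag_mat B = as" by auto
  note w = similar_mat_witD2[OF H wit]
  have "a = 0" if "a \<in> set as" for a
    using that by (intro ev) (auto simp: eigenvalue_root_char_poly[OF H] as poly_prod_list prod_list_zero_iff)
  then have B0: "B $$ (i, i) = 0" if "i < n" for i
    using that w(5) diag by (auto simp: diag_mat_def)
  have "(\<Sum>i<n. H $$ (i, i)) = (\<Sum>k<n. (Q * (P * B)) $$ (k, k))"
    unfolding w(3) using w(5-7) by (intro sum_diag_mult_commute) auto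
  also have "Q * (P * B) = (Q * P) * B"
    using w(4-7) by (intro assoc_mult_mat[symmetric]) auto
  also have "\<dots> = B" using w by simp
  finally show ?thesis using B0 by simp
qed

text \<open>The trace of the Gram matrix is the sum of the squared moduli of all entries of
  \<open>M\<close>, so it cannot vanish for nonzero \<open>M\<close>.\<close>

lemma gram_nonzero_eigenvalue:
  fixes M :: "complex mat"
  assumes M: "M \<in> carrier_mat m n" and nz: "M \<noteq> 0\<^sub>m m n"
  shows "\<exists>\<mu>. eigenvalue (mat_adjoint M * M) \<mu> \<and> \<mu> \<noteq> 0"
proof (rule ccontr)
  assume "\<not> ?thesis"
  then have "(\<Sum>i<n. (mat_adjoint M * M) $$ (i, i)) = 0"
    using M by (intro trace_eq_0_if_eigenvalues_0) auto
  also have "(\<Sum>i<n. (mat_adjoint M * M) $$ (i, i)) = of_real (\<Sum>i<n. \<Sum>k<m. (cmod (M $$ (k, i)))\<^sup>2)"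
    using M unfolding of_real_sum
    by (intro sum.cong) (auto simp: scalar_prod_def lessThan_atLeast0 complex_norm_square mult.commute
        simp del: of_real_power)
  finally have "(\<Sum>i<n. \<Sum>k<m. (cmod (M $$ (k, i)))\<^sup>2) = 0"
    using of_real_eq_0_iff by blast
  then have "M $$ (k, i) = 0" if "k < m" "i < n" for i k
    using that by (auto simp: sum_nonneg_eq_0_iff sum_nonneg)
  then show False using M nz by auto
qed

text \<open>The Gram matrix and \<open>\<mu>\<close> are real, so \<open>conjugate v\<close>
  satisfies the same eigenvector equation, and a real combination can be formed unless it
  degenerates.\<close>

lemma gram_real_eigenvector:
  fixes M :: "complex mat"
  assumes M: "M \<in> carrier_mat m n" and ev: "eigenvalue (mat_adjoint M * M) \<mu>"
    and real: "map_mat cnj M = M"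
  shows "\<exists>v. eigenvector (mat_adjoint M * M) v \<mu> \<and> conjugate v = v"
proof -
  define H where "H = mat_adjoint M * M"
  have H: "H \<in> carrier_mat n n" using M by (auto simp: H_def)
  obtain v where "eigenvector H v \<mu>" using ev unfolding H_def eigenvalue_def by blast
  then have v: "v \<in> carrier_vec n" "v \<noteq> 0\<^sub>v n" "H *\<^sub>v v = \<mu> \<cdot>\<^sub>v v"
    using H by (auto simp: eigenvector_def)
  have "\<mu> = of_real (Re \<mu>)"
    using gram_eigenvector(2)[OF M] \<open>eigenvector H v \<mu>\<close> unfolding H_def by blast
  then have mu: "cnj \<mu> = \<mu>" by (metis complex_cnj_complex_of_real)
  have "map_mat cnj H = H"
    unfolding H_def using M real by (subst map_mat_cnj_mult) (auto simp: map_mat_cnj_adjoint)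
  then have Hcnj: "cnj (H $$ (i, j)) = H $$ (i, j)" if "i < n" "j < n" for i j
    using that H by (metis carrier_matD index_map_mat(1))
  have cv: "H *\<^sub>v conjugate v = \<mu> \<cdot>\<^sub>v conjugate v"
  proof (rule eq_vecI)
    fix i assume "i < dim_vec (\<mu> \<cdot>\<^sub>v conjugate v)"
    then have i: "i < n" using v by simp
    have "(H *\<^sub>v conjugate v) $ i = (\<Sum>j<n. cnj (H $$ (i, j)) * cnj (v $ j))"
      using i v(1) H by (simp add: scalar_prod_def lessThan_atLeast0 Hcnj)
    also have "\<dots> = cnj ((H *\<^sub>v v) $ i)"
      using i v(1) H by (simp add: scalar_prod_def lessThan_atLeast0)
    also have "\<dots> = (\<mu> \<cdot>\<^sub>v conjugate v) $ i" using i v by (simp add: mu)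
    finally show "(H *\<^sub>v conjugate v) $ i = (\<mu> \<cdot>\<^sub>v conjugate v) $ i" .
  qed (use v H in auto)
  show ?thesis
  proof (cases "v + conjugate v = 0\<^sub>v n")
    case False
    have "H *\<^sub>v (v + conjugate v) = \<mu> \<cdot>\<^sub>v (v + conjugate v)"
      using v H cv by (simp add: mult_add_distrib_mat_vec[of _ n n] smult_add_distrib_vec[of _ n])
    moreover have "conjugate (v + conjugate v) = v + conjugate v"
      using v by (intro eq_vecI) (auto simp: add.commute)
    ultimately show ?thesis
      using False v H unfolding eigenvector_def H_def[symmetric]
      by (intro exI[of _ "v + conjugate v"]) auto
  next
    \<comment> \<open>Now \<open>v\<close> is purely imaginary, so multiplying by the imaginary unit
      gives a real eigenvector.\<close>
    case True
    have "v $ i + cnj (v $ i) = 0" if "i < n" for i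
      using arg_cong[OF True, of "\<lambda>w. w $ i"] that v by simp
    then have cnj_v: "cnj (v $ i) = - v $ i" if "i < n" for i
      using that by (metis add_eq_0_iff)
    have "conjugate (\<i> \<cdot>\<^sub>v v) = \<i> \<cdot>\<^sub>v v"
      using v by (intro eq_vecI) (auto simp: cnj_v)
    moreover have "H *\<^sub>v (\<i> \<cdot>\<^sub>v v) = \<mu> \<cdot>\<^sub>v (\<i> \<cdot>\<^sub>v v)"
      using v H by (simp add: mult_mat_vec[of _ n n] smult_smult_assoc mult.commute)
    moreover have "\<i> \<cdot>\<^sub>v v \<noteq> 0\<^sub>v n"
    proof
      assume z: "\<i> \<cdot>\<^sub>v v = 0\<^sub>v n"
      have "v $ i = 0" if "i < n" for i
        using arg_cong[OF z, of "\<lambda>w. w $ i"] that v by simp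
      then show False using v by auto
    qed
    ultimately show ?thesis
      using v H unfolding eigenvector_def H_def[symmetric]
      by (intro exI[of _ "\<i> \<cdot>\<^sub>v v"]) auto
  qed
qed

lemma gram_unit_eigenvector:
  fixes M :: "complex mat"
  assumes M: "M \<in> carrier_mat m n" and ev: "eigenvalue (mat_adjoint M * M) \<mu>"
  shows "\<exists>v \<in> carrier_vec n. v \<bullet>c v = 1 \<and> mat_adjoint M *\<^sub>v (M *\<^sub>v v) = \<mu> \<cdot>\<^sub>v v \<and>
           (map_mat cnj M = M \<longrightarrow> conjugate v = v)"
proof -
  obtain w where "eigenvector (mat_adjoint M * M) w \<mu>" and cnj_w: "map_mat cnj M = M \<longrightarrow> conjugate w = w"
    using gram_real_eigenvector[OF M ev] ev unfolding eigenvalue_def by metis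
  then have w: "w \<in> carrier_vec n" "w \<noteq> 0\<^sub>v n" "(mat_adjoint M * M) *\<^sub>v w = \<mu> \<cdot>\<^sub>v w"
    using M by (auto simp: eigenvector_def)
  define r where "r = (\<Sum>i<dim_vec w. (cmod (w $ i))\<^sup>2)"
  have r: "w \<bullet>c w = of_real r" unfolding r_def by (rule cscalar_prod_self)
  have "r \<ge> 0" unfolding r_def by (intro sum_nonneg) simp
  moreover have "r \<noteq> 0" using r w(1,2) by auto
  ultimately have "r > 0" by simp
  \<comment> \<open>A real normalizing factor, which keeps a real eigenvector real.\<close>
  define c where "c = complex_of_real (1 / sqrt r)"
  define v where "v = c \<cdot>\<^sub>v w"
  have c: "cnj c = c" "c * c * of_real r = 1"
    using \<open>r > 0\<close> by (auto simp: c_def simp flip: of_real_mult)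
  have "v \<bullet>c v = c * c * (w \<bullet>c w)"
    using w by (simp add: v_def conjugate_smult_vec c)
  then have "v \<bullet>c v = 1" by (simp add: r c)
  moreover have "mat_adjoint M *\<^sub>v (M *\<^sub>v v) = (mat_adjoint M * M) *\<^sub>v v"
    using M w by (intro assoc_mult_mat_vec[symmetric]) (auto simp: v_def)
  moreover have "(mat_adjoint M * M) *\<^sub>v v = \<mu> \<cdot>\<^sub>v v"
  proof -
    have "mat_adjoint M * M \<in> carrier_mat n n" using M by auto
    then show ?thesis
      using w by (simp add: v_def mult_mat_vec[OF _ w(1)] smult_smult_assoc mult.commute)
  qed
  moreover have "map_mat cnj M = M \<longrightarrow> conjugate v = v"
    using cnj_w c by (simp add: v_def conjugate_smult_vec)
  ultimately show ?thesis using w by (intro bexI[of _ v]) (auto simp: v_def)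
qed

text \<open>All eigenvalues are nonnegative reals, finitely many as roots of a nonzero polynomial,
  and not all zero; \<open>s\<close> is the square root of the largest. Taking the largest one is
  what puts the singular values in order.\<close>

lemma max_gram_eigenvalue:
  fixes M :: "complex mat"
  assumes M: "M \<in> carrier_mat m n" and nz: "M \<noteq> 0\<^sub>m m n"
  shows "\<exists>s > 0. eigenvalue (mat_adjoint M * M) (of_real (s\<^sup>2)) \<and>
           (\<forall>\<mu>. eigenvalue (mat_adjoint M * M) \<mu> \<longrightarrow> Re \<mu> \<le> s\<^sup>2)"
proof -
  define H where "H = mat_adjoint M * M"
  have H: "H \<in> carrier_mat n n" using M by (auto simp: H_def)
  have ev: "\<mu> = of_real (Re \<mu>)" "0 \<le> Re \<mu>" if "eigenvalue H \<mu>" for \<mu>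
    using that gram_eigenvector(2,3)[OF M] unfolding H_def eigenvalue_def by blast+
  have "char_poly H \<noteq> 0" using degree_monic_char_poly[OF H] by auto
  then have fin: "finite (Re ` Collect (eigenvalue H))"
    using poly_roots_finite[of "char_poly H"] eigenvalue_root_char_poly[OF H]
    by (simp add: Collect_cong[of "eigenvalue H"])
  obtain \<mu> where \<mu>: "eigenvalue H \<mu>" "\<mu> \<noteq> 0"
    using gram_nonzero_eigenvalue[OF M nz] unfolding H_def by blast
  define l where "l = Max (Re ` Collect (eigenvalue H))"
  have le: "Re \<nu> \<le> l" if "eigenvalue H \<nu>" for \<nu>
    unfolding l_def using fin that by (intro Max_ge) auto
  have "l \<in> Re ` Collect (eigenvalue H)"
    unfolding l_def using fin \<mu>(1) by (intro Max_in) auto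
  then have "eigenvalue H (of_real l)" using ev(1) by auto
  moreover have "Re \<mu> > 0" using ev[OF \<mu>(1)] \<mu>(2) by (metis less_eq_real_def of_real_0)
  then have "l > 0" using le[OF \<mu>(1)] by simp
  ultimately show ?thesis
    using le unfolding H_def by (intro exI[of _ "sqrt l"]) auto
qed

text \<open>The column equals \<open>mat_adjoint P\<close> applied to \<open>s\<close> times the
  first column of \<open>P\<close>. Used for \<open>M\<close> to clear the first column and, with
  \<open>P\<close> and \<open>Q\<close> exchanged, for its adjoint to clear the first row.\<close>

lemma unitary_sandwich_first_column:
  fixes M :: "complex mat"
  assumes P: "P \<in> unitary_mats (Suc m)" and Q: "Q \<in> carrier_mat (Suc n) (Suc n)"
    and M: "M \<in> carrier_mat (Suc m) (Suc n)"
    and eq: "M *\<^sub>v col Q 0 = s \<cdot>\<^sub>v col P 0" and i: "i < Suc m"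
  shows "(mat_adjoint P * M * Q) $$ (i, 0) = (if i = 0 then s else 0)"
proof -
  note P = unitary_matsD[OF P]
  have "col (mat_adjoint P * M * Q) 0 = col (mat_adjoint P * (M * Q)) 0"
    using P Q M by (simp add: assoc_mult_mat_dim)
  also have "\<dots> = mat_adjoint P *\<^sub>v (M *\<^sub>v col Q 0)"
    by (simp only: col_mult2[OF mat_adjoint_carrier[OF P(1)] mult_carrier_mat[OF M Q] zero_less_Suc]
        col_mult2[OF M Q zero_less_Suc])
  also have "\<dots> = s \<cdot>\<^sub>v (mat_adjoint P *\<^sub>v col P 0)"
    unfolding eq using P by (intro mult_mat_vec) auto
  also have "mat_adjoint P *\<^sub>v col P 0 = col (mat_adjoint P * P) 0"
    by (rule col_mult2[OF mat_adjoint_carrier[OF P(1)] P(1) zero_less_Suc, symmetric])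
  finally have "col (mat_adjoint P * M * Q) 0 = s \<cdot>\<^sub>v col (1\<^sub>m (Suc m)) 0"
    unfolding P(3) .
  then have "col (mat_adjoint P * M * Q) 0 $ i = (s \<cdot>\<^sub>v col (1\<^sub>m (Suc m)) 0) $ i" by simp
  then show ?thesis using i P Q M by auto
qed

lemma unitary_conj_cancel:
  fixes M :: "complex mat"
  assumes "P \<in> unitary_mats m" "Q \<in> unitary_mats n" "M \<in> carrier_mat m n"
  shows "P * (mat_adjoint P * M * Q) * mat_adjoint Q = M"
proof -
  note P = unitary_matsD[OF assms(1)] and Q = unitary_matsD[OF assms(2)]
  have "P * (mat_adjoint P * M * Q) * mat_adjoint Q = (P * mat_adjoint P) * M * (Q * mat_adjoint Q)"
    using P(1) Q(1) assms(3) by (simp add: assoc_mult_mat_dim)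
  then show ?thesis using P Q assms(3) by simp
qed

text \<open>Take a unit eigenvector \<open>v\<close> of the Gram matrix for the largest eigenvalue
  and \<open>u = M v / s\<close>. Then \<open>M v = s u\<close> and the adjoint sends
  \<open>u\<close> to \<open>s v\<close>, so completing \<open>u\<close> and \<open>v\<close> to
  unitary matrices clears the first column and the first row. Maximality of \<open>s\<close> is
  passed on for the ordering.\<close>

lemma svd_step:
  fixes M :: "complex mat"
  assumes M: "M \<in> carrier_mat (Suc m) (Suc n)" and nz: "M \<noteq> 0\<^sub>m (Suc m) (Suc n)"
  shows "\<exists>P \<in> unitary_mats (Suc m). \<exists>Q \<in> unitary_mats (Suc n). \<exists>s > 0. \<exists>X \<in> carrier_mat m n.
           M = P * bordered (of_real s) X * mat_adjoint Q \<and>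
           (\<forall>\<mu>. eigenvalue (mat_adjoint M * M) \<mu> \<longrightarrow> Re \<mu> \<le> s\<^sup>2) \<and>
           (map_mat cnj M = M \<longrightarrow> map_mat cnj P = P \<and> map_mat cnj Q = Q \<and> map_mat cnj X = X)"
proof -
  obtain s where s: "s > 0" "eigenvalue (mat_adjoint M * M) (of_real (s\<^sup>2))"
    and max: "\<And>\<mu>. eigenvalue (mat_adjoint M * M) \<mu> \<Longrightarrow> Re \<mu> \<le> s\<^sup>2"
    using max_gram_eigenvalue[OF M nz] by blast
  obtain v where v: "v \<in> carrier_vec (Suc n)" "v \<bullet>c v = 1"
    "mat_adjoint M *\<^sub>v (M *\<^sub>v v) = of_real (s\<^sup>2) \<cdot>\<^sub>v v"
    "map_mat cnj M = M \<longrightarrow> conjugate v = v"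
    using gram_unit_eigenvector[OF M s(2)] by blast
  define c where "c = complex_of_real (1 / s)"
  define u where "u = c \<cdot>\<^sub>v (M *\<^sub>v v)"
  have u: "u \<in> carrier_vec (Suc m)" using M v by (auto simp: u_def)
  have c: "cnj c = c" "c * c * of_real (s\<^sup>2) = 1" "c * of_real s = 1" "of_real s * c = 1" "c * of_real (s\<^sup>2) = of_real s"
    using s by (auto simp: c_def power2_eq_square)
  have Mv: "M *\<^sub>v v \<in> carrier_vec (Suc m)" using M v by auto
  have "(M *\<^sub>v v) \<bullet>c (M *\<^sub>v v) = of_real (s\<^sup>2)"
    using mat_adjoint_cscalar_prod[OF M Mv v(1)] v by simp
  then have "u \<bullet>c u = 1"
    using Mv c by (simp add: u_def conjugate_smult_vec del: of_real_power)
  then obtain P where P: "P \<in> unitary_mats (Suc m)" "col P 0 = u"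
    "conjugate u = u \<longrightarrow> map_mat cnj P = P"
    using unitary_first_column[OF _ u] by blast
  obtain Q where Q: "Q \<in> unitary_mats (Suc n)" "col Q 0 = v"
    "conjugate v = v \<longrightarrow> map_mat cnj Q = Q"
    using unitary_first_column[OF _ v(1,2)] by blast
  note P' = unitary_matsD[OF P(1)] and Q' = unitary_matsD[OF Q(1)]
  define N where "N = mat_adjoint P * M * Q"
  define X where "X = mat m n (\<lambda>(i, j). N $$ (Suc i, Suc j))"
  have N: "N \<in> carrier_mat (Suc m) (Suc n)" using M P' Q' by (auto simp: N_def)
  have Mcol: "M *\<^sub>v col Q 0 = of_real s \<cdot>\<^sub>v col P 0"
    unfolding P(2) Q(2) using c by (simp add: u_def smult_smult_assoc)
  have "mat_adjoint M *\<^sub>v u = c \<cdot>\<^sub>v (mat_adjoint M *\<^sub>v (M *\<^sub>v v))"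
    unfolding u_def using M Mv by (intro mult_mat_vec) auto
  then have Mcol': "mat_adjoint M *\<^sub>v col P 0 = of_real s \<cdot>\<^sub>v col Q 0"
    unfolding P(2) Q(2) using c v by (simp add: smult_smult_assoc del: of_real_power)
  have "mat_adjoint N = mat_adjoint Q * mat_adjoint M * P"
    unfolding N_def using M P' Q' by (simp add: mat_adjoint_mult assoc_mult_mat_dim)
  \<comment> \<open>The first row of \<open>N\<close> is obtained as the conjugate of the first
    column of its adjoint.\<close>
  then have row0: "mat_adjoint N $$ (j, 0) = (if j = 0 then of_real s else 0)" if "j < Suc n" for j
    using unitary_sandwich_first_column[OF Q(1) P'(1) mat_adjoint_carrier[OF M] Mcol' that] by simp
  have col0: "N $$ (i, 0) = (if i = 0 then of_real s else 0)" if "i < Suc m" for i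
    unfolding N_def by (rule unitary_sandwich_first_column[OF P(1) Q'(1) M Mcol that])
  have NX: "N = bordered (of_real s) X"
  proof (rule eq_matI)
    fix i j assume "i < dim_row (bordered (of_real s) X)" "j < dim_col (bordered (of_real s) X)"
    then have ij: "i < Suc m" "j < Suc n" by (auto simp: X_def)
    have "cnj (N $$ (0, j)) = (if j = 0 then of_real s else 0)"
      using row0[OF ij(2)] ij N by (subst (asm) index_mat_adjoint) auto
    then have "N $$ (0, j) = (if j = 0 then of_real s else 0)"
      by (metis complex_cnj_cnj complex_cnj_complex_of_real complex_cnj_zero)
    then show "N $$ (i, j) = bordered (of_real s) X $$ (i, j)"
      using col0[OF ij(1)] ij by (cases i; cases j) (auto simp: index_bordered X_def)
  qed (use N in \<open>auto simp: X_def\<close>)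
  have "M = P * N * mat_adjoint Q"
    unfolding N_def by (rule unitary_conj_cancel[OF P(1) Q(1) M, symmetric])
  moreover have "map_mat cnj P = P \<and> map_mat cnj Q = Q \<and> map_mat cnj X = X" if real: "map_mat cnj M = M"
  proof -
    have cv: "conjugate v = v" using v real by simp
    have Mr: "cnj (M $$ (i, j)) = M $$ (i, j)" if "i < Suc m" "j < Suc n" for i j
      using that M real by (metis carrier_matD index_map_mat(1))
    have "cnj (v $ j) = v $ j" if "j < Suc n" for j
      using that v(1) cv by (metis carrier_vecD conjugate_complex_def vec_index_conjugate)
    then have "conjugate u = u"
      using M v(1) by (intro eq_vecI) (auto simp: u_def c scalar_prod_def Mr)
    then have "map_mat cnj P = P" "map_mat cnj Q = Q" using P(3) Q(3) cv by auto
    then have "map_mat cnj N = N"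
      unfolding N_def using M P' Q' real
      by (subst map_mat_cnj_mult, simp, subst map_mat_cnj_mult) (auto simp: map_mat_cnj_adjoint)
    then have "map_mat cnj X = X"
      using N by (intro eq_matI) (auto simp: X_def, metis Suc_less_eq carrier_matD index_map_mat(1))
    then show ?thesis using \<open>map_mat cnj P = P\<close> \<open>map_mat cnj Q = Q\<close> by blast
  qed
  moreover have "X \<in> carrier_mat m n" by (simp add: X_def)
  ultimately show ?thesis
    using P(1) Q(1) s(1) max unfolding NX by blast
qed

text \<open>Induction by splitting off the largest singular value. The point beyond
  \<open>svd_step\<close> is that the values of the remainder do not exceed the value just split
  off.\<close>

lemma svd:
  fixes M :: "complex mat"
  assumes "M \<in> carrier_mat m n"
  shows "\<exists>P \<in> unitary_mats m. \<exists>Q \<in> unitary_mats n. \<exists>d.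
           M = P * diag_rect m n d * mat_adjoint Q \<and> antimono d \<and> (\<forall>i. 0 \<le> d i) \<and>
           (\<forall>i \<ge> min m n. d i = 0) \<and>
           (map_mat cnj M = M \<longrightarrow> map_mat cnj P = P \<and> map_mat cnj Q = Q)"
  using assms
proof (induction m arbitrary: n M)
  case (0 n M)
  then have "M = 1\<^sub>m 0 * diag_rect 0 n (\<lambda>_. 0) * mat_adjoint (1\<^sub>m n)" by auto
  then show ?case
    by (intro bexI[of _ "1\<^sub>m 0"] bexI[of _ "1\<^sub>m n"] exI[of _ "\<lambda>_. 0"] conjI)
       (auto simp: antimono_def intro!: eq_matI)
next
  case (Suc m n M)
  show ?case
  proof (cases "M = 0\<^sub>m (Suc m) n")
    case True
    then have "M = 1\<^sub>m (Suc m) * diag_rect (Suc m) n (\<lambda>_. 0) * mat_adjoint (1\<^sub>m n)"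
      by (auto simp: diag_rect_def intro!: eq_matI)
    then show ?thesis
      by (intro bexI[of _ "1\<^sub>m (Suc m)"] bexI[of _ "1\<^sub>m n"] exI[of _ "\<lambda>_. 0"] conjI)
         (auto simp: antimono_def intro!: eq_matI)
  next
    case nz: False
    \<comment> \<open>With no columns, \<open>M\<close> would equal the zero matrix, so this case is
      already covered.\<close>
    obtain n' where n: "n = Suc n'" using nz Suc.prems by (cases n) auto
    note M = Suc.prems[unfolded n]
    obtain P Q s X where P: "P \<in> unitary_mats (Suc m)" and Q: "Q \<in> unitary_mats (Suc n')"
      and s: "s > 0" and X: "X \<in> carrier_mat m n'"
      and MX: "M = P * bordered (of_real s) X * mat_adjoint Q"
      and max: "\<And>\<mu>. eigenvalue (mat_adjoint M * M) \<mu> \<Longrightarrow> Re \<mu> \<le> s\<^sup>2"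
      and cnj: "map_mat cnj M = M \<Longrightarrow> map_mat cnj P = P \<and> map_mat cnj Q = Q \<and> map_mat cnj X = X"
      using svd_step[OF M nz[unfolded n]] by metis
    obtain P' Q' d where P': "P' \<in> unitary_mats m" and Q': "Q' \<in> unitary_mats n'"
      and XD: "X = P' * diag_rect m n' d * mat_adjoint Q'" and d: "antimono d" "\<And>i. 0 \<le> d i"
      "\<And>i. i \<ge> min m n' \<Longrightarrow> d i = 0"
      and cnj': "map_mat cnj X = X \<Longrightarrow> map_mat cnj P' = P' \<and> map_mat cnj Q' = Q'"
      using Suc.IH[OF X] by metis
    \<comment> \<open>The square of \<open>d 0\<close> is an eigenvalue of the Gram matrix of
      \<open>X\<close>, hence of that of \<open>M\<close>, where \<open>s\<^sup>2\<close> is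
      maximal. If \<open>X\<close> has no rows or no columns, \<open>d 0\<close> is 0 by
      convention.\<close>
    have d0: "d 0 \<le> s"
    proof (cases "min m n' = 0")
      case True
      then show ?thesis using d(3) s by simp
    next
      case False
      have "char_poly (mat_adjoint X * X) =
          (\<Prod>a \<leftarrow> map (\<lambda>i. of_real ((d i)\<^sup>2)) [0..<n']. [:- a, 1:])"
        using d(3) by (intro char_poly_gram_svd[OF P' Q' XD]) auto
      then have "poly (char_poly (mat_adjoint X * X)) (of_real ((d 0)\<^sup>2)) = 0"
        using False by (auto simp: poly_prod_list prod_list_zero_iff upt_rec[of 0 n'])
      moreover have "char_poly (mat_adjoint M * M) = [:- of_real (s\<^sup>2), 1:] * char_poly (mat_adjoint X * X)"
        by (simp only: char_poly_gram_unitary[OF P Q bordered_carrier[OF X] MX] char_poly_gram_bordered)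
      moreover have "mat_adjoint M * M \<in> carrier_mat (Suc n') (Suc n')"
        by (intro mult_carrier_mat[OF mat_adjoint_carrier[OF M] M])
      ultimately have "eigenvalue (mat_adjoint M * M) (of_real ((d 0)\<^sup>2))"
        by (simp only: eigenvalue_root_char_poly poly_mult mult_zero_right)
      from max[OF this] have "(d 0)\<^sup>2 \<le> s\<^sup>2" by (simp only: Re_complex_of_real)
      then show ?thesis using s by (intro power2_le_imp_le[of "d 0" s]) auto
    qed
    define e where "e = case_nat s d"
    note p = unitary_matsD[OF P] and q = unitary_matsD[OF Q]
      and p' = unitary_matsD[OF P'] and q' = unitary_matsD[OF Q']
    have "bordered (of_real s) X =
        bordered 1 P' * diag_rect (Suc m) (Suc n') e * mat_adjoint (bordered 1 Q')"
      using p' q' by (simp add: e_def diag_rect_Suc mat_adjoint_bordered bordered_mult XD)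
    then have "M = (P * bordered 1 P') * diag_rect (Suc m) (Suc n') e * mat_adjoint (Q * bordered 1 Q')"
      unfolding MX using p(1) q(1) p'(1) q'(1) by (simp add: mat_adjoint_mult assoc_mult_mat_dim)
    moreover have "antimono e"
      using d(1) d0 unfolding decseq_Suc_iff e_def by (auto split: nat.splits)
    moreover have "\<forall>i. 0 \<le> e i" "\<forall>i \<ge> min (Suc m) (Suc n'). e i = 0"
      using d s by (auto simp: e_def split: nat.splits)
    moreover have "map_mat cnj (P * bordered 1 P') = P * bordered 1 P' \<and>
        map_mat cnj (Q * bordered 1 Q') = Q * bordered 1 Q'" if "map_mat cnj M = M"
      using cnj[OF that] cnj' p(1) q(1) p'(1) q'(1)
      by (subst (1 2) map_mat_cnj_mult) (auto simp: map_mat_cnj_bordered)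
    ultimately show ?thesis
      unfolding n using P Q P' Q' by (blast intro: unitary_mats_mult bordered_unitary)
  qed
qed

section \<open>The discrete Fourier transform of a tensor\<close>

lemma root_unity_power: "root_unity p ^ k = cis (2 * pi * real k / real p)"
proof -
  have "root_unity p = cis (2 * pi / real p)"
    by (simp add: root_unity_def cis_conv_exp mult_ac)
  then show ?thesis by (simp add: DeMoivre mult_ac)
qed

lemma root_unity_power_p [simp]: "p > 0 \<Longrightarrow> root_unity p ^ p = 1"
  by (simp add: root_unity_power)

lemma root_unity_power_mult_p: "p > 0 \<Longrightarrow> root_unity p ^ (p * k) = 1"
  by (simp add: power_mult)

lemma root_unity_power_mod: "p > 0 \<Longrightarrow> root_unity p ^ (k mod p * j) = root_unity p ^ (k * j)"
proof -
  assume p: "p > 0"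
  have "root_unity p ^ (k * j) = root_unity p ^ ((p * (k div p) + k mod p) * j)" by simp
  also have "\<dots> = root_unity p ^ (p * (k div p * j)) * root_unity p ^ (k mod p * j)"
    by (simp only: add_mult_distrib power_add mult.assoc)
  finally show ?thesis by (simp add: root_unity_power_mult_p[OF p])
qed

lemma root_unity_mult_cnj: "root_unity p ^ k * cnj (root_unity p) ^ k = 1"
  by (simp add: root_unity_power cis_cnj flip: complex_cnj_power cis_mult)
    (metis cis_mult cis_zero right_minus mult.commute)

lemma root_unity_power_reflect:
  assumes "k < p"
  shows "root_unity p ^ ((p - k) mod p * j) = cnj (root_unity p) ^ (k * j)"
proof -
  have p: "p > 0" using assms by simp
  have "root_unity p ^ ((p - k) mod p * j) =
      root_unity p ^ ((p - k) * j) * (root_unity p ^ (k * j) * cnj (root_unity p) ^ (k * j))"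
    by (simp add: root_unity_power_mod[OF p] root_unity_mult_cnj)
  also have "\<dots> = root_unity p ^ (((p - k) + k) * j) * cnj (root_unity p) ^ (k * j)"
    by (simp only: add_mult_distrib power_add mult.assoc)
  finally show ?thesis using assms by (simp add: root_unity_power_mult_p[OF p])
qed

text \<open>A geometric sum whose ratio is a \<open>p\<close>-th root of unity different from 1 when
  the indices differ.\<close>

lemma root_unity_orthogonality:
  assumes "k < p" "k' < p"
  shows "(\<Sum>l<p. root_unity p ^ (l * k) * cnj (root_unity p) ^ (l * k')) = (if k = k' then of_nat p else 0)"
proof (cases "k = k'")
  case True
  then show ?thesis by (simp add: root_unity_mult_cnj)
next
  case False
  \<comment> \<open>The power of \<open>root_unity p\<close> with exponent \<open>k - k'\<close>;
    the conjugate avoids subtraction of naturals.\<close>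
  define z where "z = root_unity p ^ k * cnj (root_unity p) ^ k'"
  have "z \<noteq> 1"
  proof
    assume "z = 1"
    then have "root_unity p ^ k * (root_unity p ^ k' * cnj (root_unity p) ^ k') = root_unity p ^ k'"
      by (simp add: z_def mult_ac)
    then have "root_unity p ^ k = root_unity p ^ k'" by (simp add: root_unity_mult_cnj)
    then have "cis (2 * pi * real k / real p) = cis (2 * pi * real k' / real p)"
      by (simp add: root_unity_power)
    then show False
      using bij_betw_roots_unity[of p] assms False by (auto simp: bij_betw_def inj_on_def)
  qed
  moreover have "z ^ p = (root_unity p ^ p) ^ k * cnj ((root_unity p ^ p) ^ k')"
    by (simp add: z_def power_mult_distrib mult.commute flip: power_mult)
  then have "z ^ p = 1" using assms by simp
  ultimately have "(\<Sum>l<p. z ^ l) = 0" by (simp add: sum_gp_strict)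
  moreover have "root_unity p ^ (l * k) * cnj (root_unity p) ^ (l * k') = z ^ l" for l
    by (simp add: z_def power_mult_distrib mult.commute flip: power_mult)
  ultimately show ?thesis using False by simp
qed

text \<open>Inverse after transform: the source of injectivity in
  \<open>tensors_eqI_fourier\<close>.\<close>

lemma fourier_inversion:
  assumes "l < p"
  shows "(\<Sum>k<p. cnj (root_unity p) ^ (l * k) * (\<Sum>t<p. root_unity p ^ (t * k) * f t)) = of_nat p * f l"
proof -
  have "(\<Sum>k<p. cnj (root_unity p) ^ (l * k) * (\<Sum>t<p. root_unity p ^ (t * k) * f t)) =
      (\<Sum>t<p. \<Sum>k<p. f t * (root_unity p ^ (k * t) * cnj (root_unity p) ^ (k * l)))"
    by (subst sum.swap) (simp add: sum_distrib_left mult_ac)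
  also have "\<dots> = (\<Sum>t<p. f t * (if t = l then of_nat p else 0))"
    by (intro sum.cong) (use assms in \<open>auto simp: root_unity_orthogonality simp flip: sum_distrib_left\<close>)
  also have "\<dots> = of_nat p * f l" using assms by (simp add: if_distrib cong: if_cong)
  finally show ?thesis .
qed

text \<open>Transform after inverse: the source of surjectivity in
  \<open>fourier_slice_inverse_fourier\<close>.\<close>

lemma fourier_inversion':
  assumes "k < p"
  shows "(\<Sum>l<p. root_unity p ^ (l * k) * (\<Sum>t<p. cnj (root_unity p) ^ (l * t) * f t)) = of_nat p * f k"
proof -
  have "(\<Sum>l<p. root_unity p ^ (l * k) * (\<Sum>t<p. cnj (root_unity p) ^ (l * t) * f t)) =
      (\<Sum>t<p. \<Sum>l<p. f t * (root_unity p ^ (l * k) * cnj (root_unity p) ^ (l * t)))"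
    by (subst sum.swap) (simp add: sum_distrib_left mult_ac)
  also have "\<dots> = (\<Sum>t<p. f t * (if k = t then of_nat p else 0))"
    by (intro sum.cong) (use assms in \<open>auto simp: root_unity_orthogonality simp flip: sum_distrib_left\<close>)
  also have "\<dots> = of_nat p * f k" using assms by (simp add: if_distrib cong: if_cong)
  finally show ?thesis .
qed

text \<open>The map \<open>t \<mapsto> (p - t) mod p\<close> is negation modulo \<open>p\<close>, an
  involution; the reduction matters only at \<open>t = 0\<close>.\<close>

lemma reflect_reflect: "t < p \<Longrightarrow> (p - (p - t) mod p) mod p = (t :: nat)"
  by (cases "t = 0") auto

lemma sum_reflect: "(\<Sum>t<p. f ((p - t) mod p)) = (\<Sum>t<p. f t)" for p :: nat
  by (rule sum.reindex_bij_witness[of _ "\<lambda>t. (p - t) mod p" "\<lambda>t. (p - t) mod p"])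
     (auto simp: reflect_reflect)

text \<open>A cyclic shift becomes multiplication by a power of the root: the core of the
  convolution theorem behind \<open>fourier_slice_t_prod\<close>.\<close>

lemma fourier_shift:
  assumes "l < p"
  shows "(\<Sum>t<p. root_unity p ^ (t * k) * f ((p + t - l) mod p)) =
           root_unity p ^ (l * k) * (\<Sum>u<p. root_unity p ^ (u * k) * f u)"
proof -
  have p: "p > 0" using assms by simp
  have 1: "((p + t - l) mod p + l) mod p = t" if "t < p" for t
    using that assms by (subst mod_add_left_eq) simp
  have 2: "(p + (u + l) mod p - l) mod p = u" if "u < p" for u
  proof (cases "u + l < p")
    case True then show ?thesis using that by simp
  next
    case False
    then have "(u + l) mod p = u + l - p" using that assms by (simp add: mod_if)
    then show ?thesis using that False by simp
  qed
  have "(\<Sum>t<p. root_unity p ^ (t * k) * f ((p + t - l) mod p)) =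
      (\<Sum>u<p. root_unity p ^ ((u + l) mod p * k) * f u)"
    by (rule sum.reindex_bij_witness[of _ "\<lambda>u. (u + l) mod p" "\<lambda>t. (p + t - l) mod p"])
       (use p in \<open>auto simp: 1 2\<close>)
  also have "\<dots> = root_unity p ^ (l * k) * (\<Sum>u<p. root_unity p ^ (u * k) * f u)"
    unfolding root_unity_power_mod[OF p] sum_distrib_left
    by (simp add: algebra_simps power_add)
  finally show ?thesis .
qed

section \<open>The tensor operations read off from transformed slices\<close>

lemma fourier_slice_carrier [simp]: "fourier_slice m n p A k \<in> carrier_mat m n"
  by (simp add: fourier_slice_def)

lemma dim_fourier_slice [simp]:
  "dim_row (fourier_slice m n p A k) = m" "dim_col (fourier_slice m n p A k) = n"
  by (auto simp: fourier_slice_def)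

lemma index_fourier_slice:
  "i < m \<Longrightarrow> j < n \<Longrightarrow> fourier_slice m n p A k $$ (i, j) = (\<Sum>l<p. root_unity p ^ (l * k) * of_real (A i j l))"
  by (simp add: fourier_slice_def)

lemma sum_block_index: "(\<Sum>b<s * p. f b) = (\<Sum>l<p. \<Sum>a<s. f (l * s + a))" for s p :: nat
proof -
  have "(\<Sum>l<p. \<Sum>a<s. f (l * s + a)) = (\<Sum>l<p. sum f {l * s..<l * s + s})"
  proof (rule sum.cong[OF refl])
    fix l assume "l \<in> {..<p}"
    show "(\<Sum>a<s. f (l * s + a)) = sum f {l * s..<l * s + s}"
      using sum.shift_bounds_nat_ivl[of f 0 "l * s" s] by (simp add: lessThan_atLeast0 add.commute)
  qed
  also have "\<dots> = (\<Sum>b<s * p. f b)" by (simp add: sum.nat_group mult.commute)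
  finally show ?thesis by simp
qed

text \<open>Written out, the T-product is a matrix product combined with cyclic convolution along
  the third index.\<close>

lemma index_t_prod:
  assumes "i < m" "j < n" "k < p"
  shows "t_prod m s n p A B i j k = (\<Sum>l<p. \<Sum>a<s. A i a ((p + k - l) mod p) * B a j l)"
proof -
  have "t_prod m s n p A B i j k = (\<Sum>b<s * p. A i (b mod s) ((p + k - b div s) mod p) * B (b mod s) j (b div s))"
    using assms
    by (simp add: t_prod_def fold_tensor_def bcirc_def unfold_tensor_def block_index_less
        scalar_prod_def lessThan_atLeast0)
  also have "\<dots> = (\<Sum>l<p. \<Sum>a<s. A i a ((p + k - l) mod p) * B a j l)"
    unfolding sum_block_index by (intro sum.cong) auto
  finally show ?thesis .
qed

lemma fourier_slice_t_prod:
  "fourier_slice m n p (t_prod m s n p A B) k = fourier_slice m s p A k * fourier_slice s n p B k"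
proof (rule eq_matI, goal_cases)
  case (1 i j)
  then have ij: "i < m" "j < n" by auto
  have "fourier_slice m n p (t_prod m s n p A B) k $$ (i, j) =
      (\<Sum>t<p. \<Sum>l<p. \<Sum>a<s. root_unity p ^ (t * k) * of_real (A i a ((p + t - l) mod p)) * of_real (B a j l))"
    using ij by (simp add: index_fourier_slice index_t_prod sum_distrib_left mult.assoc)
  also have "\<dots> = (\<Sum>l<p. \<Sum>a<s. \<Sum>t<p. root_unity p ^ (t * k) * of_real (A i a ((p + t - l) mod p)) * of_real (B a j l))"
    by (subst sum.swap) (intro sum.cong refl sum.swap)
  also have "\<dots> = (\<Sum>l<p. \<Sum>a<s. fourier_slice m s p A k $$ (i, a) * (root_unity p ^ (l * k) * of_real (B a j l)))"
  proof (intro sum.cong refl)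
    fix l a assume "l \<in> {..<p}" "a \<in> {..<s}"
    then have "(\<Sum>t<p. root_unity p ^ (t * k) * of_real (A i a ((p + t - l) mod p))) =
        root_unity p ^ (l * k) * fourier_slice m s p A k $$ (i, a)"
      using ij fourier_shift[of l p k "\<lambda>u. of_real (A i a u)"] by (simp add: index_fourier_slice)
    then show "(\<Sum>t<p. root_unity p ^ (t * k) * of_real (A i a ((p + t - l) mod p)) * of_real (B a j l)) =
        fourier_slice m s p A k $$ (i, a) * (root_unity p ^ (l * k) * of_real (B a j l))"
      unfolding sum_distrib_right[symmetric] by (simp add: mult_ac)
  qed
  also have "\<dots> = (\<Sum>a<s. fourier_slice m s p A k $$ (i, a) * fourier_slice s n p B k $$ (a, j))"
    using ij by (subst sum.swap) (simp add: index_fourier_slice sum_distrib_left)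
  finally show ?case using ij by (simp add: scalar_prod_def lessThan_atLeast0)
qed auto

lemma index_t_transpose:
  assumes "i < n" "j < m" "k < p"
  shows "t_transpose m n p A i j k = A j i ((p - k) mod p)"
proof -
  have "j < m * p" using block_index_less[of j m 0 p] assms by simp
  then show ?thesis
    using assms by (simp add: t_transpose_def bcirc_inv_def bcirc_def block_index_less)
qed

text \<open>The entries are real, so conjugation acts only on the powers of the root, where it
  negates the exponent.\<close>

lemma fourier_slice_reflect:
  assumes "k < p"
  shows "fourier_slice m n p A ((p - k) mod p) = map_mat cnj (fourier_slice m n p A k)"
proof (rule eq_matI, goal_cases)
  case (1 i j)
  then show ?case
    using root_unity_power_reflect[OF assms] by (simp add: index_fourier_slice mult.commute[of _ "(p - k) mod p"] mult.commute[of _ k])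
qed auto

text \<open>The T-transpose also negates the slice index modulo \<open>p\<close>; under the
  transform this supplies the conjugation that turns a transpose into an adjoint.\<close>

lemma fourier_slice_t_transpose:
  "fourier_slice n m p (t_transpose m n p A) k = mat_adjoint (fourier_slice m n p A k)"
proof (rule eq_matI, goal_cases)
  case (1 i j)
  then have ij: "i < n" "j < m" by auto
  have "fourier_slice n m p (t_transpose m n p A) k $$ (i, j) =
      (\<Sum>t<p. root_unity p ^ (t * k) * of_real (A j i ((p - t) mod p)))"
    using ij by (simp add: index_fourier_slice index_t_transpose)
  also have "\<dots> = (\<Sum>t<p. root_unity p ^ ((p - (p - t) mod p) mod p * k) * of_real (A j i ((p - t) mod p)))"
    by (intro sum.cong) (auto simp: reflect_reflect)
  also have "\<dots> = (\<Sum>u<p. root_unity p ^ ((p - u) mod p * k) * of_real (A j i u))"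
    by (rule sum_reflect)
  also have "\<dots> = cnj (fourier_slice m n p A k $$ (j, i))"
    using ij by (simp add: index_fourier_slice root_unity_power_reflect)
  finally show ?case using ij by simp
qed auto

lemma index_t_identity:
  assumes "i < n" "j < n" "k < p"
  shows "t_identity n p i j k = (if i = j \<and> k = 0 then 1 else 0)"
proof -
  have "j < n * p" using block_index_less[of j n 0 p] assms by simp
  moreover have "k * n + i = j \<longleftrightarrow> i = j \<and> k = 0"
    using assms by (cases k) auto
  ultimately show ?thesis
    using assms by (auto simp: t_identity_def bcirc_inv_def block_index_less)
qed

lemma fourier_slice_t_identity:
  assumes "p > 0"
  shows "fourier_slice n n p (t_identity n p) k = 1\<^sub>m n"
proof (rule eq_matI, goal_cases)
  case (1 i j)
  then have "fourier_slice n n p (t_identity n p) k $$ (i, j) =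
      (\<Sum>l<p. root_unity p ^ (l * k) * of_real (if i = j \<and> l = 0 then 1 else 0))"
    by (simp add: index_fourier_slice index_t_identity)
  also have "\<dots> = (\<Sum>l<p. if l = 0 then if i = j then 1 else 0 else 0)"
    by (rule sum.cong) auto
  finally show ?case using 1 assms by simp
qed auto

lemma t_prod_tensors [simp]: "t_prod m s n p A B \<in> tensors m n p"
  by (auto simp: t_prod_def fold_tensor_def tensors_def)

lemma t_transpose_tensors [simp]: "t_transpose m n p A \<in> tensors n m p"
  by (auto simp: t_transpose_def bcirc_inv_def tensors_def)

lemma t_identity_tensors [simp]: "t_identity n p \<in> tensors n n p"
  by (auto simp: t_identity_def bcirc_inv_def tensors_def)

lemma tensors_eqI_fourier:
  assumes A: "A \<in> tensors m n p" and B: "B \<in> tensors m n p"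
    and eq: "\<And>k. k < p \<Longrightarrow> fourier_slice m n p A k = fourier_slice m n p B k"
  shows "A = B"
proof (intro ext)
  fix i j l
  show "A i j l = B i j l"
  proof (cases "i < m \<and> j < n \<and> l < p")
    case True
    then have ij: "i < m" "j < n" and l: "l < p" by auto
    have "(\<Sum>t<p. root_unity p ^ (t * k) * complex_of_real (A i j t)) =
        (\<Sum>t<p. root_unity p ^ (t * k) * complex_of_real (B i j t))" if "k < p" for k
      using arg_cong[OF eq[OF that], of "\<lambda>M. M $$ (i, j)"] ij by (simp add: index_fourier_slice)
    then have "(\<Sum>k<p. cnj (root_unity p) ^ (l * k) * (\<Sum>t<p. root_unity p ^ (t * k) * complex_of_real (A i j t))) =
        (\<Sum>k<p. cnj (root_unity p) ^ (l * k) * (\<Sum>t<p. root_unity p ^ (t * k) * complex_of_real (B i j t)))"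
      by (intro sum.cong) auto
    then have "of_nat p * complex_of_real (A i j l) = of_nat p * complex_of_real (B i j l)"
      unfolding fourier_inversion[OF l] .
    then show ?thesis using l by simp
  next
    case False
    then show ?thesis using A B by (auto simp: tensors_def)
  qed
qed

text \<open>\<open>Re\<close> makes the result a real tensor for any family; on conjugate symmetric
  families the sums are real and nothing is lost.\<close>

definition inverse_fourier :: "nat \<Rightarrow> nat \<Rightarrow> nat \<Rightarrow> (nat \<Rightarrow> complex mat) \<Rightarrow> tensor" where
  "inverse_fourier m n p X =
     (\<lambda>i j l. if i < m \<and> j < n \<and> l < p
        then Re (1 / of_nat p * (\<Sum>k<p. cnj (root_unity p) ^ (l * k) * X k $$ (i, j))) else 0)"

lemma inverse_fourier_tensors [simp]: "inverse_fourier m n p X \<in> tensors m n p"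
  by (auto simp: inverse_fourier_def tensors_def)

lemma fourier_slice_inverse_fourier:
  assumes X: "\<And>k. k < p \<Longrightarrow> X k \<in> carrier_mat m n"
    and reflect: "\<And>k. k < p \<Longrightarrow> X ((p - k) mod p) = map_mat cnj (X k)"
    and k: "k < p"
  shows "fourier_slice m n p (inverse_fourier m n p X) k = X k"
proof (rule eq_matI, goal_cases)
  case (1 i j)
  then have ij: "i < m" "j < n" using X[OF k] by auto
  define S where "S = (\<lambda>l. \<Sum>k<p. cnj (root_unity p) ^ (l * k) * X k $$ (i, j))"
  have "cnj (S l) = S l" for l
  proof -
    \<comment> \<open>Conjugating the summands amounts to replacing \<open>k\<close> by its negative
      modulo \<open>p\<close>, which only permutes the sum; hence \<open>S l\<close> is
      real.\<close>
    have "cnj (S l) = (\<Sum>k<p. root_unity p ^ (k * l) * X ((p - k) mod p) $$ (i, j))"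
      unfolding S_def cnj_sum using ij
      by (intro sum.cong) (auto simp: mult.commute[of l] reflect carrier_matD[OF X])
    also have "\<dots> = (\<Sum>k<p. root_unity p ^ ((p - (p - k) mod p) mod p * l) * X ((p - k) mod p) $$ (i, j))"
      by (intro sum.cong) (auto simp: reflect_reflect)
    also have "\<dots> = (\<Sum>k<p. root_unity p ^ ((p - k) mod p * l) * X k $$ (i, j))"
      by (rule sum_reflect)
    also have "\<dots> = S l"
      unfolding S_def by (intro sum.cong) (auto simp: root_unity_power_reflect mult.commute[of l])
    finally show ?thesis .
  qed
  then have "complex_of_real (Re (1 / of_nat p * S l)) = 1 / of_nat p * S l" for l
    by (metis Reals_cnj_iff complex_cnj_divide complex_cnj_mult complex_cnj_of_nat complex_cnj_one of_real_Re)
  then have "complex_of_real (inverse_fourier m n p X i j l) = 1 / of_nat p * S l" if "l < p" for l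
    using ij that by (simp only: inverse_fourier_def S_def simp_thms if_True)
  then have "fourier_slice m n p (inverse_fourier m n p X) k $$ (i, j) =
      (\<Sum>l<p. root_unity p ^ (l * k) * (1 / of_nat p * S l))"
    using ij by (simp add: index_fourier_slice)
  also have "\<dots> = 1 / of_nat p * (\<Sum>l<p. root_unity p ^ (l * k) * S l)"
    by (simp add: sum_distrib_left)
  also have "\<dots> = X k $$ (i, j)"
    unfolding S_def fourier_inversion'[OF k] using k by simp
  finally show ?case .
qed (use X[OF k] in auto)

section \<open>Orthogonal equivalence and the Kilmer--Martin mapping\<close>

lemma orthogonal_tensors_iff:
  assumes p: "p > 0"
  shows "U \<in> orthogonal_tensors m p \<longleftrightarrow>
           U \<in> tensors m m p \<and> (\<forall>k<p. fourier_slice m m p U k \<in> unitary_mats m)"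
proof -
  have "T = t_identity m p \<longleftrightarrow> (\<forall>k<p. fourier_slice m m p T k = 1\<^sub>m m)"
    if "T \<in> tensors m m p" for T
    using tensors_eqI_fourier[OF that t_identity_tensors] fourier_slice_t_identity[OF p] by auto
  then show ?thesis
    by (auto simp: orthogonal_tensors_def unitary_mats_def fourier_slice_t_prod fourier_slice_t_transpose)
qed

text \<open>The factors remain tensors: unitary slices chosen independently for each
  \<open>k\<close> need not come from real tensors.\<close>

lemma orth_equiv_iff:
  assumes p: "p > 0"
  shows "(A, B) \<in> orth_equiv m n p \<longleftrightarrow> A \<in> tensors m n p \<and> B \<in> tensors m n p \<and>
    (\<exists>U \<in> orthogonal_tensors m p. \<exists>V \<in> orthogonal_tensors n p. \<forall>k<p.
       fourier_slice m n p A k =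
         fourier_slice m m p U k * fourier_slice m n p B k * mat_adjoint (fourier_slice n n p V k))"
proof -
  have "A = t_prod m n n p (t_prod m m n p U B) (t_transpose n n p V) \<longleftrightarrow>
    (\<forall>k<p. fourier_slice m n p A k =
         fourier_slice m m p U k * fourier_slice m n p B k * mat_adjoint (fourier_slice n n p V k))"
    if "A \<in> tensors m n p" for U V
    using tensors_eqI_fourier[OF that t_prod_tensors, of n "t_prod m m n p U B" "t_transpose n n p V"]
    by (auto simp: fourier_slice_t_prod fourier_slice_t_transpose)
  then show ?thesis by (simp add: orth_equiv_def cong: conj_cong)
qed

lemma orthogonal_tensors_identity: "p > 0 \<Longrightarrow> t_identity n p \<in> orthogonal_tensors n p"
  by (simp add: orthogonal_tensors_iff fourier_slice_t_identity)

lemma orthogonal_tensors_transpose: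
  assumes "p > 0" "U \<in> orthogonal_tensors n p"
  shows "t_transpose n n p U \<in> orthogonal_tensors n p"
  using assms by (simp add: orthogonal_tensors_iff fourier_slice_t_transpose)

lemma orthogonal_tensors_mult:
  assumes "p > 0" "U \<in> orthogonal_tensors n p" "V \<in> orthogonal_tensors n p"
  shows "t_prod n n n p U V \<in> orthogonal_tensors n p"
  using assms by (simp add: orthogonal_tensors_iff fourier_slice_t_prod unitary_mats_mult)

lemma orth_equiv_refl:
  assumes "p > 0" "A \<in> tensors m n p"
  shows "(A, A) \<in> orth_equiv m n p"
  unfolding orth_equiv_iff[OF assms(1)]
  using assms orthogonal_tensors_identity[OF assms(1)]
  by (intro conjI bexI[of _ "t_identity m p"] bexI[of _ "t_identity n p"])
     (auto simp: fourier_slice_t_identity)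

lemma orth_equiv_sym:
  assumes p: "p > 0" and AB: "(A, B) \<in> orth_equiv m n p"
  shows "(B, A) \<in> orth_equiv m n p"
proof -
  obtain U V where UV: "U \<in> orthogonal_tensors m p" "V \<in> orthogonal_tensors n p"
    and eq: "\<And>k. k < p \<Longrightarrow> fourier_slice m n p A k =
         fourier_slice m m p U k * fourier_slice m n p B k * mat_adjoint (fourier_slice n n p V k)"
    and tensors: "A \<in> tensors m n p" "B \<in> tensors m n p"
    using AB unfolding orth_equiv_iff[OF p] by auto
  have "fourier_slice m n p B k =
      fourier_slice m m p (t_transpose m m p U) k * fourier_slice m n p A k *
        mat_adjoint (fourier_slice n n p (t_transpose n n p V) k)" if "k < p" for k
    using unitary_conj_cancel[of "mat_adjoint (fourier_slice m m p U k)" m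
        "mat_adjoint (fourier_slice n n p V k)" n "fourier_slice m n p B k"] UV that
    by (simp add: fourier_slice_t_transpose eq orthogonal_tensors_iff[OF p])
  then show ?thesis
    unfolding orth_equiv_iff[OF p]
    using tensors UV p by (blast intro: orthogonal_tensors_transpose)
qed

lemma orth_equiv_trans:
  assumes p: "p > 0" and AB: "(A, B) \<in> orth_equiv m n p" and BC: "(B, C) \<in> orth_equiv m n p"
  shows "(A, C) \<in> orth_equiv m n p"
proof -
  obtain U V where UV: "U \<in> orthogonal_tensors m p" "V \<in> orthogonal_tensors n p"
    and eq: "\<And>k. k < p \<Longrightarrow> fourier_slice m n p A k =
         fourier_slice m m p U k * fourier_slice m n p B k * mat_adjoint (fourier_slice n n p V k)"
    and A: "A \<in> tensors m n p"
    using AB unfolding orth_equiv_iff[OF p] by auto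
  obtain U' V' where UV': "U' \<in> orthogonal_tensors m p" "V' \<in> orthogonal_tensors n p"
    and eq': "\<And>k. k < p \<Longrightarrow> fourier_slice m n p B k =
         fourier_slice m m p U' k * fourier_slice m n p C k * mat_adjoint (fourier_slice n n p V' k)"
    and C: "C \<in> tensors m n p"
    using BC unfolding orth_equiv_iff[OF p] by auto
  have "fourier_slice m n p A k =
      fourier_slice m m p (t_prod m m m p U U') k * fourier_slice m n p C k *
        mat_adjoint (fourier_slice n n p (t_prod n n n p V V') k)" if "k < p" for k
    using that by (simp add: fourier_slice_t_prod eq eq' mat_adjoint_mult assoc_mult_mat_dim)
  then show ?thesis
    unfolding orth_equiv_iff[OF p]
    using A C UV UV' p by (blast intro: orthogonal_tensors_mult)
qed

lemma equiv_orth_equiv: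
  assumes "p > 0"
  shows "equiv (tensors m n p) (orth_equiv m n p)"
proof (rule equivI)
  show "orth_equiv m n p \<subseteq> tensors m n p \<times> tensors m n p"
    by (auto simp: orth_equiv_def)
  show "refl_on (tensors m n p) (orth_equiv m n p)"
    using orth_equiv_refl[OF assms] by (auto simp: refl_on_def)
  show "sym (orth_equiv m n p)" using orth_equiv_sym[OF assms] by (auto intro: symI)
  show "trans (orth_equiv m n p)" using orth_equiv_trans[OF assms] by (blast intro: transI)
qed

section \<open>Invariance of singular values and properties of the Kilmer--Martin mapping\<close>

lemma singular_values_unitary:
  assumes "P \<in> unitary_mats m" "Q \<in> unitary_mats n" "M \<in> carrier_mat m n"
  shows "singular_values (P * M * mat_adjoint Q) = singular_values M"
  using char_poly_gram_unitary[OF assms refl] by (simp add: singular_values_def)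

lemma svd_singular_values:
  fixes M :: "complex mat"
  assumes M: "M \<in> carrier_mat m n"
  shows "\<exists>P \<in> unitary_mats m. \<exists>Q \<in> unitary_mats n.
           M = P * diag_rect m n (\<lambda>i. singular_values M ! i) * mat_adjoint Q \<and>
           (map_mat cnj M = M \<longrightarrow> map_mat cnj P = P \<and> map_mat cnj Q = Q)"
proof -
  obtain P Q d where PQ: "P \<in> unitary_mats m" "Q \<in> unitary_mats n"
    and eq: "M = P * diag_rect m n d * mat_adjoint Q" and d: "antimono d" "\<And>i. 0 \<le> d i"
    "\<And>i. i \<ge> min m n \<Longrightarrow> d i = 0"
    and real: "map_mat cnj M = M \<longrightarrow> map_mat cnj P = P \<and> map_mat cnj Q = Q"
    using svd[OF M] by metis
  have "singular_values M = map d [0..<n]"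
    using d by (intro singular_values_svd[OF PQ eq]) auto
  then have "diag_rect m n d = diag_rect m n (\<lambda>i. singular_values M ! i)"
    by (intro eq_matI) (auto simp: diag_rect_def)
  then show ?thesis using PQ eq real by metis
qed

text \<open>The two matrices differ by the unitary factors of a decomposition of \<open>M\<close>.
  This is idempotence of the Kilmer--Martin mapping on a single slice.\<close>

lemma singular_values_diag_rect_singular_values:
  fixes M :: "complex mat"
  assumes M: "M \<in> carrier_mat m n"
  shows "singular_values (diag_rect m n (\<lambda>i. singular_values M ! i)) = singular_values M"
proof -
  obtain P Q where "P \<in> unitary_mats m" "Q \<in> unitary_mats n"
    "M = P * diag_rect m n (\<lambda>i. singular_values M ! i) * mat_adjoint Q"
    using svd_singular_values[OF M] by blast
  then show ?thesis using singular_values_unitary[OF _ _ diag_rect_carrier] by metis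
qed

lemma map_mat_cnj_diag_rect [simp]: "map_mat cnj (diag_rect m n d) = diag_rect m n d"
  by (rule eq_matI) (auto simp: diag_rect_def)

text \<open>Conjugating the factors of a decomposition fixes the diagonal. Hence the diagonals for
  \<open>k\<close> and \<open>p - k\<close> agree, and they form the slices of a real
  tensor.\<close>

lemma singular_values_cnj:
  fixes M :: "complex mat"
  assumes M: "M \<in> carrier_mat m n"
  shows "singular_values (map_mat cnj M) = singular_values M"
proof -
  define D where "D = diag_rect m n (\<lambda>i. singular_values M ! i)"
  obtain P Q where PQ: "P \<in> unitary_mats m" "Q \<in> unitary_mats n" "M = P * D * mat_adjoint Q"
    using svd_singular_values[OF M] unfolding D_def by blast
  note P = unitary_matsD[OF PQ(1)] and Q = unitary_matsD[OF PQ(2)]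
  have D: "D \<in> carrier_mat m n" "map_mat cnj D = D" by (auto simp: D_def)
  have "map_mat cnj M = map_mat cnj (P * D) * map_mat cnj (mat_adjoint Q)"
    unfolding PQ(3) using P(1) Q(1) D(1) by (intro map_mat_cnj_mult) auto
  also have "map_mat cnj (P * D) = map_mat cnj P * D"
    using P(1) D by (subst map_mat_cnj_mult) auto
  finally have "map_mat cnj M = map_mat cnj P * D * mat_adjoint (map_mat cnj Q)"
    by (simp add: map_mat_cnj_adjoint)
  then show ?thesis
    using singular_values_unitary[OF unitary_mats_cnj[OF PQ(1)] unitary_mats_cnj[OF PQ(2)] D(1)]
      singular_values_diag_rect_singular_values[OF M] by (simp add: D_def)
qed

lemma kilmer_martin_inverse_fourier:
  "kilmer_martin m n p A =
     inverse_fourier m n p (\<lambda>k. diag_rect m n (\<lambda>i. singular_values (fourier_slice m n p A k) ! i))"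
  by (intro ext) (auto simp: kilmer_martin_def inverse_fourier_def diag_rect_def)

lemma kilmer_martin_tensors [simp]: "kilmer_martin m n p A \<in> tensors m n p"
  by (simp add: kilmer_martin_inverse_fourier)

lemma fourier_slice_kilmer_martin:
  assumes "k < p"
  shows "fourier_slice m n p (kilmer_martin m n p A) k =
           diag_rect m n (\<lambda>i. singular_values (fourier_slice m n p A k) ! i)"
  unfolding kilmer_martin_inverse_fourier
  using assms
  by (intro fourier_slice_inverse_fourier)
     (auto simp: fourier_slice_reflect singular_values_cnj[OF fourier_slice_carrier])

lemma kilmer_martin_cong:
  assumes "\<And>k. k < p \<Longrightarrow> singular_values (fourier_slice m n p A k) = singular_values (fourier_slice m n p B k)"
  shows "kilmer_martin m n p A = kilmer_martin m n p B"
proof -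
  have "(\<Sum>l<p. cnj (root_unity p) ^ (k * l) * complex_of_real (singular_values (fourier_slice m n p A l) ! i)) =
      (\<Sum>l<p. cnj (root_unity p) ^ (k * l) * complex_of_real (singular_values (fourier_slice m n p B l) ! i))"
    for i k by (intro sum.cong) (auto simp: assms)
  then show ?thesis unfolding kilmer_martin_def by presburger
qed

lemma kilmer_martin_orth_equiv:
  assumes p: "p > 0" and AB: "(A, B) \<in> orth_equiv m n p"
  shows "kilmer_martin m n p A = kilmer_martin m n p B"
proof (rule kilmer_martin_cong)
  fix k assume k: "k < p"
  obtain U V where "U \<in> orthogonal_tensors m p" "V \<in> orthogonal_tensors n p"
    and "fourier_slice m n p A k =
         fourier_slice m m p U k * fourier_slice m n p B k * mat_adjoint (fourier_slice n n p V k)"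
    using AB k unfolding orth_equiv_iff[OF p] by auto
  then show "singular_values (fourier_slice m n p A k) = singular_values (fourier_slice m n p B k)"
    using k singular_values_unitary[OF _ _ fourier_slice_carrier] by (simp add: orthogonal_tensors_iff[OF p])
qed

lemma kilmer_martin_idem: "kilmer_martin m n p (kilmer_martin m n p A) = kilmer_martin m n p A"
  by (rule kilmer_martin_cong)
     (simp add: fourier_slice_kilmer_martin singular_values_diag_rect_singular_values[OF fourier_slice_carrier])

text \<open>
  The factors of the slices with index \<open>2 k > p\<close> are the conjugates of those with index
  \<open>p - k\<close>; the self-conjugate slices \<open>k = 0\<close> and \<open>2 k = p\<close> need real factors.
\<close>

lemma orth_equiv_kilmer_martin:
  assumes p: "p > 0" and A: "A \<in> tensors m n p"
  shows "(A, kilmer_martin m n p A) \<in> orth_equiv m n p"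
proof -
  define \<Delta> where "\<Delta> = fourier_slice m n p A"
  define D where "D = (\<lambda>k. diag_rect m n (\<lambda>i. singular_values (\<Delta> k) ! i))"
  have "\<exists>P Q. P \<in> unitary_mats m \<and> Q \<in> unitary_mats n \<and> \<Delta> k = P * D k * mat_adjoint Q \<and>
      (map_mat cnj (\<Delta> k) = \<Delta> k \<longrightarrow> map_mat cnj P = P \<and> map_mat cnj Q = Q)" for k
    using svd_singular_values[of "\<Delta> k" m n] unfolding D_def by (auto simp: \<Delta>_def)
  then obtain P Q where PQ: "\<And>k. P k \<in> unitary_mats m" "\<And>k. Q k \<in> unitary_mats n"
    "\<And>k. \<Delta> k = P k * D k * mat_adjoint (Q k)"
    "\<And>k. map_mat cnj (\<Delta> k) = \<Delta> k \<Longrightarrow> map_mat cnj (P k) = P k \<and> map_mat cnj (Q k) = Q k"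
    by metis
  define sel :: "(nat \<Rightarrow> complex mat) \<Rightarrow> nat \<Rightarrow> complex mat" where
    "sel X k = (if 2 * k \<le> p then X k else map_mat cnj (X (p - k)))" for X k
  have reflect: "\<Delta> ((p - k) mod p) = map_mat cnj (\<Delta> k)" if "k < p" for k
    unfolding \<Delta>_def by (rule fourier_slice_reflect[OF that])
  have real: "map_mat cnj (P k) = P k" "map_mat cnj (Q k) = Q k" if "k < p" "k = 0 \<or> 2 * k = p" for k
  proof -
    have "(p - k) mod p = k" using that by auto
    then have "map_mat cnj (\<Delta> k) = \<Delta> k" using reflect[OF that(1)] by simp
    then show "map_mat cnj (P k) = P k" "map_mat cnj (Q k) = Q k" using PQ(4) by auto
  qed
  have sel_reflect: "sel X ((p - k) mod p) = map_mat cnj (sel X k)"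
    if "k < p" and "\<And>k. k < p \<Longrightarrow> k = 0 \<or> 2 * k = p \<Longrightarrow> map_mat cnj (X k) = X k" for X k
  proof -
    consider "k = 0" | "2 * k = p" | "0 < k" "2 * k < p" | "2 * k > p" by linarith
    then show ?thesis
    proof cases
      case 2
      then have "p - k = k" by simp
      then show ?thesis using 2 that by (simp add: sel_def)
    qed (use that p in \<open>auto simp: sel_def\<close>)
  qed
  have sel_unitary: "sel X k \<in> unitary_mats l" if "\<And>k. X k \<in> unitary_mats l" for X k l
    using that unitary_mats_cnj by (auto simp: sel_def)
  have slice: "fourier_slice l l p (inverse_fourier l l p (sel X)) k = sel X k"
    if "k < p" "\<And>k. X k \<in> unitary_mats l"
      "\<And>k. k < p \<Longrightarrow> k = 0 \<or> 2 * k = p \<Longrightarrow> map_mat cnj (X k) = X k" for X k l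
    using that sel_reflect unitary_matsD(1)[OF sel_unitary[OF that(2)]]
    by (intro fourier_slice_inverse_fourier) auto
  have D: "D k \<in> carrier_mat m n" "map_mat cnj (D k) = D k" for k by (auto simp: D_def)
  have "\<Delta> k = sel P k * D k * mat_adjoint (sel Q k)" if k: "k < p" for k
  proof (cases "2 * k \<le> p")
    case True
    then show ?thesis using PQ(3)[of k] by (simp add: sel_def)
  next
    case False
    then have pk: "(p - k) mod p = p - k" using k by simp
    have "singular_values (\<Delta> (p - k)) = singular_values (\<Delta> k)"
      using reflect[OF k] singular_values_cnj[of "\<Delta> k" m n] by (simp add: pk \<Delta>_def)
    \<comment> \<open>The slices \<open>k\<close> and \<open>p - k\<close> share their diagonal
      factor, so conjugating the outer factors alone decomposes slice \<open>k\<close>.\<close>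
    then have Dk: "D (p - k) = D k" by (simp add: D_def)
    have "\<Delta> k = map_mat cnj (\<Delta> (p - k))" using reflect[OF k] by (simp add: pk)
    also have "\<dots> = map_mat cnj (P (p - k) * D k) * map_mat cnj (mat_adjoint (Q (p - k)))"
      unfolding PQ(3)[of "p - k"] Dk
      using unitary_matsD(1)[OF PQ(1)[of "p - k"]] unitary_matsD(1)[OF PQ(2)[of "p - k"]] D(1)[of k]
      by (intro map_mat_cnj_mult) auto
    also have "map_mat cnj (P (p - k) * D k) = map_mat cnj (P (p - k)) * D k"
      using unitary_matsD(1)[OF PQ(1)[of "p - k"]] D[of k] by (subst map_mat_cnj_mult) auto
    finally show ?thesis using False by (simp add: sel_def map_mat_cnj_adjoint)
  qed
  moreover define U where "U = inverse_fourier m m p (sel P)"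
  moreover define V where "V = inverse_fourier n n p (sel Q)"
  moreover have U: "fourier_slice m m p U k = sel P k" and V: "fourier_slice n n p V k = sel Q k"
    if "k < p" for k
    unfolding U_def V_def using that PQ(1,2) real by (intro slice; blast)+
  moreover have "fourier_slice m n p (kilmer_martin m n p A) k = D k" if "k < p" for k
    using that by (simp add: D_def \<Delta>_def fourier_slice_kilmer_martin)
  ultimately have "\<forall>k<p. \<Delta> k = fourier_slice m m p U k *
      fourier_slice m n p (kilmer_martin m n p A) k * mat_adjoint (fourier_slice n n p V k)"
    by simp
  moreover have "U \<in> orthogonal_tensors m p" "V \<in> orthogonal_tensors n p"
    using U V sel_unitary[of P, OF PQ(1)] sel_unitary[of Q, OF PQ(2)]
    by (auto simp: orthogonal_tensors_iff[OF p] U_def V_def)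
  ultimately show ?thesis
    unfolding orth_equiv_iff[OF p] \<Delta>_def using A kilmer_martin_tensors by blast
qed

lemma s_diagonal_iff: "s_diagonal m n p S \<longleftrightarrow> (\<exists>A \<in> tensors m n p. S = kilmer_martin m n p A)"
  by (auto simp: s_diagonal_def f_diagonal_tensors_def kilmer_martin_tensors)
     (simp_all add: kilmer_martin_def)

section \<open>Cardinality of the classes\<close>

text \<open>Dedekind cuts: a function is determined by the rationals below each of its values, that
  is, by a subset of a countable set. Working with all functions lets every class embed by
  inclusion.\<close>

lemma real_functions_lepoll_reals: "(UNIV :: (nat \<Rightarrow> nat \<Rightarrow> nat \<Rightarrow> real) set) \<lesssim> (UNIV :: real set)"
proof -
  define cut :: "(nat \<Rightarrow> nat \<Rightarrow> nat \<Rightarrow> real) \<Rightarrow> (nat \<times> nat \<times> nat \<times> rat) set" where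
    "cut A = {(i, j, k, q). of_rat q < A i j k}" for A
  have "A i j k \<le> B i j k" if "cut A = cut B" for A B i j k
  proof (rule ccontr)
    assume "\<not> ?thesis"
    then obtain q where "B i j k < of_rat q" "of_rat q < A i j k"
      using of_rat_dense[of "B i j k" "A i j k"] by auto
    then have "(i, j, k, q) \<in> cut A" "(i, j, k, q) \<notin> cut B" by (auto simp: cut_def)
    with that show False by simp
  qed
  then have "A i j k = B i j k" if "cut A = cut B" for A B i j k
    using that by (metis order_antisym)
  then have "inj cut" by (intro injI ext) blast
  moreover have "inj (\<lambda>X. to_nat ` (X :: (nat \<times> nat \<times> nat \<times> rat) set))"
    by (rule injI) (simp add: inj_image_eq_iff)
  ultimately have "inj ((\<lambda>X. to_nat ` X) \<circ> cut)" by (rule inj_compose[rotated])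
  then have "(UNIV :: (nat \<Rightarrow> nat \<Rightarrow> nat \<Rightarrow> real) set) \<lesssim> (UNIV :: nat set set)"
    unfolding lepoll_def by blast
  then show ?thesis using nat_sets_eqpoll_reals lepoll_trans2 by blast
qed

definition rotation :: "nat \<Rightarrow> nat \<Rightarrow> real \<Rightarrow> nat \<Rightarrow> nat \<Rightarrow> real" where
  "rotation a b t i j =
     (if i = a then if j = a then cos t else if j = b then - sin t else 0
      else if i = b then if j = a then sin t else if j = b then cos t else 0
      else if i = j then 1 else 0)"

text \<open>With only slice 0 nonzero, all transformed slices equal the same plane rotation, and the
  T-product rotates each frontal slice by the ordinary matrix product.\<close>

definition rotation_tensor :: "nat \<Rightarrow> nat \<Rightarrow> nat \<Rightarrow> real \<Rightarrow> tensor" where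
  "rotation_tensor m a b t = (\<lambda>i j k. if i < m \<and> j < m \<and> k = 0 then rotation a b t i j else 0)"

lemma rotation_tensor_orthogonal:
  assumes p: "p > 0" and ab: "a < m" "b < m" "a \<noteq> b"
  shows "rotation_tensor m a b t \<in> orthogonal_tensors m p"
proof -
  define R where "R = rotation a b t"
  define M where "M = mat m m (\<lambda>(i, j). complex_of_real (R i j))"
  have slice: "fourier_slice m m p (rotation_tensor m a b t) k = M" for k
  proof (rule eq_matI, goal_cases)
    case (1 i j)
    then have ij: "i < m" "j < m" by (auto simp: M_def)
    then have "fourier_slice m m p (rotation_tensor m a b t) k $$ (i, j) =
        (\<Sum>l<p. root_unity p ^ (l * k) * of_real (if l = 0 then R i j else 0))"
      by (simp add: index_fourier_slice rotation_tensor_def R_def cong: if_cong)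
    also have "\<dots> = (\<Sum>l<p. if l = 0 then of_real (R i j) else 0)"
      by (rule sum.cong) auto
    finally show ?case using ij p by (simp add: M_def)
  qed (auto simp: M_def)
  have cs: "cos t * cos t + sin t * sin t = 1" "sin t * sin t + cos t * cos t = 1"
    using sin_cos_squared_add3[of t] by (simp_all add: add.commute)
  have "(\<Sum>k<m. R k i * R k j) = (if i = j then 1 else 0)" if ij: "i < m" "j < m" for i j
  proof -
    \<comment> \<open>Outside rows \<open>a\<close> and \<open>b\<close> the rotation is the
      identity, so a further term can only arise for \<open>k = i = j\<close>.\<close>
    have "(\<Sum>k<m. R k i * R k j) = (\<Sum>k<m. (if k = a then R a i * R a j else 0) +
        (if k = b then R b i * R b j else 0) +
        (if k = i then if i = j \<and> i \<noteq> a \<and> i \<noteq> b then 1 else 0 else 0))"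
      using ab by (intro sum.cong) (auto simp: R_def rotation_def)
    also have "\<dots> = R a i * R a j + R b i * R b j + (if i = j \<and> i \<noteq> a \<and> i \<noteq> b then 1 else 0)"
      using ab ij by (simp add: sum.distrib)
    also have "\<dots> = (if i = j then 1 else 0)"
      using ab cs by (auto simp: R_def rotation_def)
    finally show ?thesis .
  qed
  then have sum: "(\<Sum>k<m. complex_of_real (R k i) * of_real (R k j)) = (if i = j then 1 else 0)"
    if "i < m" "j < m" for i j
    using that by (simp flip: of_real_mult of_real_sum)
  have "mat_adjoint M * M = 1\<^sub>m m"
    using sum by (intro eq_matI) (auto simp: M_def scalar_prod_def lessThan_atLeast0)
  then have "M \<in> unitary_mats m"
    by (intro unitary_matsI) (auto simp: M_def)
  moreover have "rotation_tensor m a b t \<in> tensors m m p"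
    using p by (auto simp: tensors_def rotation_tensor_def)
  ultimately show ?thesis
    using p by (simp add: orthogonal_tensors_iff slice)
qed

text \<open>In the cyclic convolution only \<open>l = k\<close> meets the nonzero slice 0 of the
  rotation.\<close>

lemma index_t_prod_rotation_tensor:
  assumes "i < m" "j < n" "k < p"
  shows "t_prod m m n p (rotation_tensor m a b t) A i j k = (\<Sum>r<m. rotation a b t i r * A r j k)"
proof -
  have eq0: "(p + k - l) mod p = 0 \<longleftrightarrow> l = k" if "l < p" for l
  proof (cases "l \<le> k")
    case True
    then have "p + k - l = p + (k - l)" by simp
    then have "(p + k - l) mod p = k - l"
      using assms(3) by (metis less_imp_diff_less mod_add_self1 mod_less)
    then show ?thesis using True by auto
  qed (use assms that in auto)
  have "t_prod m m n p (rotation_tensor m a b t) A i j k =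
      (\<Sum>l<p. if l = k then \<Sum>r<m. rotation a b t i r * A r j k else 0)"
    unfolding index_t_prod[OF assms] using assms
    by (intro sum.cong) (auto simp: rotation_tensor_def eq0)
  then show ?thesis using assms by simp
qed

lemma t_prod_in_orth_class:
  assumes p: "p > 0" and A: "A \<in> tensors m n p" and U: "U \<in> orthogonal_tensors m p"
  shows "t_prod m m n p U A \<in> orth_class m n p A"
proof -
  have "fourier_slice m n p (t_prod m m n p U A) k = fourier_slice m m p U k *
      fourier_slice m n p A k * mat_adjoint (fourier_slice n n p (t_identity n p) k)" for k
    using right_mult_one_mat[of "fourier_slice m m p U k * fourier_slice m n p A k" m n]
    by (simp add: fourier_slice_t_prod fourier_slice_t_identity[OF p])
  then have "(t_prod m m n p U A, A) \<in> orth_equiv m n p"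
    unfolding orth_equiv_iff[OF p] using A U orthogonal_tensors_identity[OF p, of n] t_prod_tensors
    by blast
  \<comment> \<open>\<open>orth_class\<close> collects the second components of pairs starting with
    \<open>A\<close>, so the pair just found is turned around.\<close>
  then show ?thesis using orth_equiv_sym[OF p] by (simp add: orth_class_def)
qed

text \<open>For the lower bound, rotate the row of a nonzero entry against another row by the angles
  in \<open>{0..pi}\<close>. Two entries of the product already determine the angle.\<close>

lemma orth_class_eqpoll_reals_rows:
  assumes p: "p > 0" and m: "m \<ge> 2" and A: "A \<in> tensors m n p" "A \<noteq> zero_tensor"
  shows "orth_class m n p A \<approx> (UNIV :: real set)"
proof (rule lepoll_antisym)
  have "orth_class m n p A \<lesssim> (UNIV :: (nat \<Rightarrow> nat \<Rightarrow> nat \<Rightarrow> real) set)"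
    by (rule subset_imp_lepoll) simp
  then show "orth_class m n p A \<lesssim> (UNIV :: real set)"
    using real_functions_lepoll_reals lepoll_trans by blast
  have "\<exists>a j k. A a j k \<noteq> 0"
    using A(2) unfolding zero_tensor_def fun_eq_iff by blast
  then obtain a j k where "A a j k \<noteq> 0" by blast
  moreover from this have ijk: "a < m" "j < n" "k < p" using A(1) by (auto simp: tensors_def)
  moreover obtain b where b: "b < m" "a \<noteq> b"
    using m by (metis One_nat_def Suc_1 Suc_le_lessD zero_less_one_class.zero_less_one less_trans zero_neq_one)
  define x y where "x = A a j k" and "y = A b j k"
  define B where "B t = t_prod m m n p (rotation_tensor m a b t) A" for t
  have Ba: "B t a j k = cos t * x - sin t * y" for t
  proof -
    have "B t a j k = (\<Sum>r<m. (if r = a then cos t * x else 0) + (if r = b then - sin t * y else 0))"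
      unfolding B_def index_t_prod_rotation_tensor[OF ijk] using b
      by (intro sum.cong) (auto simp: rotation_def x_def y_def)
    then show ?thesis using ijk b by (simp add: sum.distrib)
  qed
  have Bb: "B t b j k = sin t * x + cos t * y" for t
  proof -
    have "B t b j k = (\<Sum>r<m. (if r = a then sin t * x else 0) + (if r = b then cos t * y else 0))"
      unfolding B_def index_t_prod_rotation_tensor[OF b(1) ijk(2,3)] using b
      by (intro sum.cong) (auto simp: rotation_def x_def y_def)
    then show ?thesis using ijk b by (simp add: sum.distrib)
  qed
  \<comment> \<open>The inner product of the rotated pair with \<open>(x, y)\<close>. It recovers
    the cosine because \<open>(x, y)\<close> is nonzero, and the cosine is injective on
    \<open>{0..pi}\<close>.\<close>
  have cos: "cos t * (x * x + y * y) = B t a j k * x + B t b j k * y" for t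
    unfolding Ba Bb by (simp add: algebra_simps)
  have "x * x + y * y \<noteq> 0"
    using \<open>A a j k \<noteq> 0\<close> by (simp add: x_def sum_squares_eq_zero_iff)
  then have "inj_on B {0..pi}"
    using cos by (intro inj_onI) (metis atLeastAtMost_iff cos_inj_pi mult_cancel_right)
  moreover have "B ` {0..pi} \<subseteq> orth_class m n p A"
    unfolding B_def using t_prod_in_orth_class[OF p A(1)] rotation_tensor_orthogonal[OF p ijk(1) b] by auto
  ultimately have "{0..pi} \<lesssim> orth_class m n p A" unfolding lepoll_def by blast
  moreover have "(UNIV :: real set) \<approx> {0..pi}"
    using closed_interval_eqpoll_reals[of 0 pi] eqpoll_sym by (simp add: eqpoll_sym)
  ultimately show "(UNIV :: real set) \<lesssim> orth_class m n p A"
    using lepoll_trans1 by blast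
qed

section \<open>Transposition, trading columns for rows\<close>

lemma t_transpose_t_transpose:
  "A \<in> tensors m n p \<Longrightarrow> t_transpose n m p (t_transpose m n p A) = A"
  by (rule tensors_eqI_fourier) (auto simp: fourier_slice_t_transpose)

text \<open>Taking adjoints of the slices exchanges the roles of \<open>U\<close> and
  \<open>V\<close>.\<close>

lemma t_transpose_orth_equiv:
  assumes p: "p > 0" and AB: "(A, B) \<in> orth_equiv m n p"
  shows "(t_transpose m n p A, t_transpose m n p B) \<in> orth_equiv n m p"
proof -
  obtain U V where UV: "U \<in> orthogonal_tensors m p" "V \<in> orthogonal_tensors n p"
    and "\<forall>k<p. fourier_slice m n p A k =
         fourier_slice m m p U k * fourier_slice m n p B k * mat_adjoint (fourier_slice n n p V k)"
    using AB unfolding orth_equiv_iff[OF p] by auto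
  then have "\<forall>k<p. fourier_slice n m p (t_transpose m n p A) k = fourier_slice n n p V k *
      fourier_slice n m p (t_transpose m n p B) k * mat_adjoint (fourier_slice m m p U k)"
    by (simp add: fourier_slice_t_transpose mat_adjoint_mult assoc_mult_mat_dim)
  then show ?thesis
    unfolding orth_equiv_iff[OF p] using UV t_transpose_tensors by blast
qed

lemma orth_class_t_transpose_eqpoll:
  assumes p: "p > 0" and A: "A \<in> tensors m n p"
  shows "orth_class m n p A \<approx> orth_class n m p (t_transpose m n p A)"
proof -
  have "bij_betw (t_transpose m n p) (orth_class m n p A) (orth_class n m p (t_transpose m n p A))"
  proof (rule bij_betw_byWitness[of _ "t_transpose n m p"])
    have sub: "orth_class r s p C \<subseteq> tensors r s p" for r s C
      by (auto simp: orth_class_def orth_equiv_def)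
    show "\<forall>B \<in> orth_class m n p A. t_transpose n m p (t_transpose m n p B) = B"
      "\<forall>B \<in> orth_class n m p (t_transpose m n p A). t_transpose m n p (t_transpose n m p B) = B"
      using sub t_transpose_t_transpose by blast+
    show "t_transpose m n p ` orth_class m n p A \<subseteq> orth_class n m p (t_transpose m n p A)"
      using t_transpose_orth_equiv[OF p] by (auto simp: orth_class_def)
    show "t_transpose n m p ` orth_class n m p (t_transpose m n p A) \<subseteq> orth_class m n p A"
      using t_transpose_orth_equiv[OF p, of "t_transpose m n p A" _ n m]
      by (auto simp: orth_class_def t_transpose_t_transpose[OF A])
  qed
  then show ?thesis unfolding eqpoll_def by blast
qed

lemma orth_class_eqpoll_reals:
  assumes p: "p > 0" and mn: "m \<ge> 2 \<or> n \<ge> 2" and A: "A \<in> tensors m n p" "A \<noteq> zero_tensor"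
  shows "orth_class m n p A \<approx> (UNIV :: real set)"
proof (cases "m \<ge> 2")
  case True
  then show ?thesis using orth_class_eqpoll_reals_rows[OF p _ A] by blast
next
  case False
  have "t_transpose m n p A \<noteq> zero_tensor"
  proof
    assume "t_transpose m n p A = zero_tensor"
    then have "A = t_transpose n m p zero_tensor" using t_transpose_t_transpose[OF A(1)] by simp
    also have "\<dots> = zero_tensor"
    proof (intro ext)
      fix i j k
      show "t_transpose n m p zero_tensor i j k = zero_tensor i j k"
        using t_transpose_tensors[of n m p zero_tensor] index_t_transpose[of i m j n k p zero_tensor]
        by (cases "i < m \<and> j < n \<and> k < p") (auto simp: tensors_def zero_tensor_def)
    qed
    finally show False using A(2) by simp
  qed
  then have "orth_class n m p (t_transpose m n p A) \<approx> (UNIV :: real set)"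
    using False mn p by (intro orth_class_eqpoll_reals_rows) auto
  then show ?thesis using orth_class_t_transpose_eqpoll[OF p A(1)] eqpoll_trans by blast
qed

theorem theorem4p4:
  fixes m n p :: nat
  assumes "m > 0" and "n > 0" and "p \<ge> 2"
  shows
    "(equiv (tensors m n p) (orth_equiv m n p) \<and>
      partition_on (tensors m n p) (tensors m n p // orth_equiv m n p)) \<and>
     (\<forall>C \<in> tensors m n p // orth_equiv m n p. \<exists>!S. S \<in> C \<and> s_diagonal m n p S) \<and>
     ((m, n) \<noteq> (1, 1) \<longrightarrow>
      (\<forall>A \<in> tensors m n p. \<forall>B \<in> tensors m n p.
         A \<noteq> zero_tensor \<and> B \<noteq> zero_tensor \<longrightarrow>
         (\<exists>f. bij_betw f (orth_class m n p A) (orth_class m n p B)))) \<and>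
     (\<forall>S S'. s_diagonal m n p S \<and> s_diagonal m n p S' \<and> (S, S') \<in> orth_equiv m n p \<longrightarrow> S = S') \<and>
     (\<forall>C \<in> tensors m n p // orth_equiv m n p.
        (\<forall>A \<in> C. \<forall>B \<in> C.
           tubal_rank m n p A = tubal_rank m n p B \<and>
           (\<forall>i < min m n. t_singular_value m n p A i = t_singular_value m n p B i)) \<and>
        (\<forall>S \<in> C. s_diagonal m n p S \<longrightarrow>
           (\<forall>A \<in> C.
              tubal_rank m n p A = card {i. i < min m n \<and> (\<exists>k < p. S i i k \<noteq> 0)} \<and>
              (\<forall>i < min m n. t_singular_value m n p A i = sqrt (\<Sum>k<p. (S i i k)\<^sup>2)))))"
proof -
  have p: "p > 0" using assms by simp
  note eq = equiv_orth_equiv[OF p, of m n]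
  have s_diagonal: "kilmer_martin m n p S = S" if "s_diagonal m n p S" for S
    using that kilmer_martin_idem by (auto simp: s_diagonal_iff)
  have quot: "(A, B) \<in> orth_equiv m n p" "A \<in> tensors m n p"
    if "C \<in> tensors m n p // orth_equiv m n p" "A \<in> C" "B \<in> C" for A B C
    using that quotient_eq_iff[OF eq that(1,1,2,3)] in_quotient_imp_subset[OF eq that(1)] by auto
  \<comment> \<open>Both tensors are fixed by the Kilmer--Martin mapping, which is constant on
    classes.\<close>
  have unique: "S = S'" if "s_diagonal m n p S" "s_diagonal m n p S'" "(S, S') \<in> orth_equiv m n p" for S S'
    using kilmer_martin_orth_equiv[OF p that(3)] s_diagonal that(1,2) by simp
  have ii: "\<exists>!S. S \<in> C \<and> s_diagonal m n p S" if C: "C \<in> tensors m n p // orth_equiv m n p" for C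
  proof -
    obtain A where A: "A \<in> C" using in_quotient_imp_non_empty[OF eq C] by blast
    have At: "A \<in> tensors m n p" using quot(2)[OF C A A] .
    have "kilmer_martin m n p A \<in> C"
      using in_quotient_imp_closed[OF eq C A] orth_equiv_kilmer_martin[OF p At] .
    moreover have "s_diagonal m n p (kilmer_martin m n p A)" using At by (auto simp: s_diagonal_iff)
    ultimately show ?thesis using unique quot(1)[OF C] by blast
  qed
  have iii: "\<exists>f. bij_betw f (orth_class m n p A) (orth_class m n p B)"
    if "(m, n) \<noteq> (1, 1)" "A \<in> tensors m n p" "B \<in> tensors m n p" "A \<noteq> zero_tensor" "B \<noteq> zero_tensor"
    for A B
  proof -
    have "m \<ge> 2 \<or> n \<ge> 2" using that(1) assms by auto
    then have "orth_class m n p A \<approx> (UNIV :: real set)" "orth_class m n p B \<approx> (UNIV :: real set)"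
      using that p by (auto intro: orth_class_eqpoll_reals)
    then have "orth_class m n p A \<approx> orth_class m n p B" by (rule eqpoll_trans[OF _ eqpoll_sym])
    then show ?thesis by (simp add: eqpoll_def)
  qed
  have same: "kilmer_martin m n p A = kilmer_martin m n p B"
    if "C \<in> tensors m n p // orth_equiv m n p" "A \<in> C" "B \<in> C" for A B C
    using kilmer_martin_orth_equiv[OF p quot(1)[OF that]] .
  \<comment> \<open>By \<open>same\<close> and \<open>s_diagonal\<close>, the image of any member of
    the class is the s-diagonal member \<open>S\<close>, so rank and singular values, defined from
    that image, are read off from \<open>S\<close>.\<close>
  have v: "\<forall>C \<in> tensors m n p // orth_equiv m n p.
      (\<forall>A \<in> C. \<forall>B \<in> C. tubal_rank m n p A = tubal_rank m n p B \<and>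
         (\<forall>i < min m n. t_singular_value m n p A i = t_singular_value m n p B i)) \<and>
      (\<forall>S \<in> C. s_diagonal m n p S \<longrightarrow>
         (\<forall>A \<in> C. tubal_rank m n p A = card {i. i < min m n \<and> (\<exists>k < p. S i i k \<noteq> 0)} \<and>
            (\<forall>i < min m n. t_singular_value m n p A i = sqrt (\<Sum>k<p. (S i i k)\<^sup>2))))"
  proof (intro ballI conjI impI, goal_cases)
    case (1 C A B)
    then have "kilmer_martin m n p A = kilmer_martin m n p B" using same by blast
    then show ?case by (simp add: tubal_rank_def)
  next
    case (2 C A B)
    then have "kilmer_martin m n p A = kilmer_martin m n p B" using same by blast
    then show ?case by (simp add: t_singular_value_def)
  next
    case (3 C S A)
    then have "kilmer_martin m n p A = S" using same[of C A S] s_diagonal[of S] by simp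
    then show ?case by (simp add: tubal_rank_def)
  next
    case (4 C S A)
    then have "kilmer_martin m n p A = S" using same[of C A S] s_diagonal[of S] by simp
    then show ?case by (simp add: t_singular_value_def)
  qed
  show ?thesis
    by (intro conjI eq partition_on_quotient[OF eq] v) (use ii iii unique in blast)+
qed

end
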